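(* Let $V^{[*]}$ be a dg vertex operator algebra. The map $\eta_{F^\bullet W_\bullet}:R^{[*]}(V^{[*]})\to\operatorname{gr}_*\operatorname{gr}^{[*]}A(V^{[*]})$ defined for $u\in V_n^{[p]}$ by $$u+C_2^{[p]}(V^{[*]})_n\mapsto u+O(V^{[*]})+\bigoplus_{q\le p,\,m<n}V_m^{[q]}+\bigoplus_{q<p,\,m\le n}V_m^{[q]}$$ is a surjective morphism of weight graded dg Poisson algebras.
   Context: All vector spaces are over $\mathbb C$. A (cochain) complex $V^{[*]}=\bigoplus_{p\in\mathbb Z}V^{[p]}$ has a differential $d_V$ of degree $+1$ with $d_V^2=0$; $|v|=p$ for $v\in V^{[p]}$. $\operatorname{End}^{[*]}(V^{[*]})=\bigoplus_p\operatorname{End}^{[p]}(V^{[*]})$, where $\operatorname{End}^{[p]}$ is the space of linear maps of degree $p$. A dg vertex algebra $(V^{[*]},d_V,Y(\cdot,x),\mathbf 1)$ is a complex with a linear map $v\mapsto Y(v,x)=\sum_{n\in\mathbb Z}v_nx^{-n-1}\in\operatorname{End}^{[*]}(V^{[*]})[[x,x^{-1}]]$ such that for $v\in V^{[p]}$ one has $v_n\in\operatorname{End}^{[p-2n-2]}(V^{[*]})$ and $(d_Vv)_n=d_V\circ v_n-(-1)^{p}v_n\circ d_V$, and a vector $\mathbf 1\in V^{[0]}$ with $d_V\mathbf 1=0$, such that: $u_nv=0$ for $n$ sufficiently large; $Y(\mathbf 1,x)=\operatorname{id}$; $Y(v,x)\mathbf 1\in V^{[*]}[[x]]$ with constant term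 $v$; and (Jacobi identity) for homogeneous $u,v$ and all $l,m,n\in\mathbb Z$, $$\sum_{i\ge0}(-1)^i\binom li\left(u_{m+l-i}v_{n+i}-(-1)^{l}(-1)^{|u||v|}v_{n+l-i}u_{m+i}\right)=\sum_{i\ge0}\binom mi(u_{l+i}v)_{m+n-i}.$$ A dg vertex operator algebra is a dg vertex algebra with $\omega\in V^{[4]}$, $d_V\omega=0$, such that, writing $Y(\omega,x)=\sum_nL(n)x^{-n-2}$: $[L(m),L(n)]=(m-n)L(m+n)+\frac1{12}(m^3-m)\delta_{m+n,0}c_V$ for some $c_V\in\mathbb C$; $L(0)$ is semisimple with $V^{[*]}=\bigoplus_{n\in\frac12\mathbb Z}V_n^{[*]}$, $V_n^{[*]}$ the eigenspace of eigenvalue (weight) $n$, $\omega\in V_2^{[*]}$, $\dim V_n^{[*]}<\infty$, $V_n^{[*]}=0$ for $n\ll0$; and $L(-1)v=v_{-2}\mathbf 1$. Put $V_n^{[p]}=V_n^{[*]}\cap V^{[p]}$ and $\operatorname{wt}(u)=n$ for $u\in V_n^{[*]}$. $C_2$-algebra: $C_2^{[*]}(V^{[*]})=\operatorname{Span}\{u_{-2}v\}$, bigraded with parts $C_2^{[p]}(V^{[*]})_n=C_2^{[*]}(V^{[*]})\cap V_n^{[p]}$; $R^{[*]}(V^{[*]})=V^{[*]}/C_2^{[*]}(V^{[*]})$ is a weight graded, graded commutative dg Poisson algebra with product $\overline u\cdot\overline v=\overline{u_{-1}v}$, bracket $\{\overline u,\overline v\}=\overline{u_0v}$ (degree $-2$,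 weight $-1$), and differential induced by $d_V$. Zhu algebra: for $u$ weight homogeneous (extended linearly in $u$), $u\ast v=\sum_{n\ge0}\binom{\operatorname{wt}(u)}{n}u_{n-1}v$ and $u\circ v=\sum_{n\ge0}\binom{\operatorname{wt}(u)}{n}u_{n-2}v$; $O(V^{[*]})$ is the span of all $u\circ v$, and $A(V^{[*]})=V^{[*]}/O(V^{[*]})$ with product $\ast$. The associated bigraded algebra for its filtrations by cohomological degree and weight is $$\operatorname{gr}_*\operatorname{gr}^{[*]}A(V^{[*]})=\bigoplus_{p,n}\left(V_n^{[p]}\bmod I_n^{[p]}\right),\qquad I_n^{[p]}=O(V^{[*]})+\bigoplus_{q\le p,\,m<n}V_m^{[q]}+\bigoplus_{q<p,\,m\le n}V_m^{[q]},$$ ($V_n^{[p]}\bmod I_n^{[p]}$ being the image of $V_n^{[p]}$ in $V^{[*]}/I_n^{[p]}$), with product induced by $\ast$, differential induced by $d_V$, and bracket of the classes of $u\in V_{n_1}^{[p_1]}$, $v\in V_{n_2}^{[p_2]}$ equal to the class of $u\ast v-(-1)^{p_1p_2}v\ast u$ modulo $I_{n_1+n_2-1}^{[p_1+p_2-2]}$; it is a weight graded dg Poisson algebra. A dg Poisson algebra with bracket of even degree is an associative dg algebra with a bracket satisfying graded skew symmetry, graded Jacobi, $\{a,bc\}=\{a,b\}c+(-1)^{|a||b|}b\{a,c\}$ and $d\{a,b\}=\{da,b\}+(-1)^{|a|}\{a,db\}$. Morphisms of weight graded dg Poisson algebras preserve both gradings, differentials, products and brackets. *)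

theory Defs
  imports
    Complex_Main
    "HOL-Library.Groups_Big_Fun"
    "HOL-Library.Set_Algebras"
    "HOL-Algebra.Module"
    "HOL-Algebra.Algebraic_Closure_Type"
begin

text \<open>
  The vector space underlying a dg vertex algebra is a whole type with its scalar multiplication
  as an explicit argument; quotients and direct sums of quotients are carrier-based structures in
  the sense of HOL-Algebra whose elements are (families of) cosets.
  \<open>Sum_any\<close> is the sum of a family with finite support.  All sums taken below have finite
  support once the axioms of a dg vertex operator algebra hold.
\<close>

section \<open>Direct sum decompositions\<close>

definition decomposition :: "('i \<Rightarrow> 'a::comm_monoid_add set) \<Rightarrow> 'a \<Rightarrow> ('i \<Rightarrow> 'a) \<Rightarrow> bool" where
  "decomposition W v f \<longleftrightarrow> (\<forall>i. f i \<in> W i) \<and> finite {i. f i \<noteq> 0} \<and> v = Sum_any f"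

definition is_direct_sum :: "('i \<Rightarrow> 'a::comm_monoid_add set) \<Rightarrow> bool" where
  "is_direct_sum W \<longleftrightarrow> (\<forall>v. \<exists>!f. decomposition W v f)"

definition component :: "('i \<Rightarrow> 'a::comm_monoid_add set) \<Rightarrow> 'i \<Rightarrow> 'a \<Rightarrow> 'a" where
  "component W i v = (THE f. decomposition W v f) i"

definition sgn_pow :: "int \<Rightarrow> complex" where
  "sgn_pow k = (-1) powi k"


section \<open>Dg vertex operator algebras\<close>

text \<open>\<open>mode V v n\<close> is the operator $v_n$ in $Y(v,x) = \sum_n v_n x^{-n-1}$.\<close>

record 'a dg_va =
  scl :: "complex \<Rightarrow> 'a \<Rightarrow> 'a"
  deg_part :: "int \<Rightarrow> 'a set"
  codiff :: "'a \<Rightarrow> 'a"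
  mode :: "'a \<Rightarrow> int \<Rightarrow> 'a \<Rightarrow> 'a"
  vac :: 'a

record 'a dg_voa = "'a dg_va" +
  conf :: 'a

locale dg_vertex_algebra = vector_space "scl V"
  for V :: "('a::ab_group_add, 'm) dg_va_scheme" +
  assumes deg_subspace: "subspace (deg_part V p)"
    and deg_direct_sum: "is_direct_sum (deg_part V)"
    and codiff_linear: "Vector_Spaces.linear (scl V) (scl V) (codiff V)"
    and codiff_degree: "v \<in> deg_part V p \<Longrightarrow> codiff V v \<in> deg_part V (p + 1)"
    and codiff_codiff: "codiff V (codiff V v) = 0"
    and mode_linear_left: "Vector_Spaces.linear (scl V) (scl V) (\<lambda>v. mode V v n w)"
    and mode_linear_right: "Vector_Spaces.linear (scl V) (scl V) (mode V v n)"
    and mode_degree: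
      "\<lbrakk>v \<in> deg_part V p; w \<in> deg_part V q\<rbrakk> \<Longrightarrow> mode V v n w \<in> deg_part V (q + (p - 2 * n - 2))"
    and mode_codiff:
      "v \<in> deg_part V p \<Longrightarrow>
        mode V (codiff V v) n w =
          codiff V (mode V v n w) - scl V (sgn_pow p) (mode V v n (codiff V w))"
    and vac_degree: "vac V \<in> deg_part V 0"
    and codiff_vac: "codiff V (vac V) = 0"
    and truncation: "\<exists>N. \<forall>n\<ge>N. mode V u n v = 0"
    and vac_mode: "mode V (vac V) n v = (if n = -1 then v else 0)"
    and creation_regular: "n \<ge> 0 \<Longrightarrow> mode V v n (vac V) = 0"
    and creation: "mode V v (-1) (vac V) = v"
    and jacobi:
      "\<lbrakk>u \<in> deg_part V p; v \<in> deg_part V q\<rbrakk> \<Longrightarrow>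
        Sum_any (\<lambda>i::nat. scl V ((-1) ^ i * (of_int l gchoose i))
          (mode V u (m + l - int i) (mode V v (n + int i) w)
           - scl V (sgn_pow l * sgn_pow (p * q))
               (mode V v (n + l - int i) (mode V u (m + int i) w))))
        = Sum_any (\<lambda>i::nat. scl V (of_int m gchoose i)
            (mode V (mode V u (l + int i) v) (m + n - int i) w))"

text \<open>$Y(\omega,x) = \sum_n L(n) x^{-n-2}$, so $L(n) = \omega_{n+1}$.\<close>

definition Vir :: "('a, 'm) dg_voa_scheme \<Rightarrow> int \<Rightarrow> 'a \<Rightarrow> 'a" where
  "Vir V n = mode V (conf V) (n + 1)"

definition weight_space :: "('a::ab_group_add, 'm) dg_voa_scheme \<Rightarrow> real \<Rightarrow> 'a set" where
  "weight_space V n = {v. Vir V 0 v = scl V (of_real n) v}"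

locale dg_vertex_operator_algebra = dg_vertex_algebra V
  for V :: "('a::ab_group_add, 'm) dg_voa_scheme" +
  assumes conf_degree: "conf V \<in> deg_part V 4"
    and codiff_conf: "codiff V (conf V) = 0"
    and virasoro:
      "\<exists>c::complex. \<forall>m n v.
        Vir V m (Vir V n v) - Vir V n (Vir V m v) =
          scl V (of_int (m - n)) (Vir V (m + n) v)
          + scl V (if m + n = 0 then of_int (m ^ 3 - m) / 12 * c else 0) v"
    and weight_direct_sum: "is_direct_sum (weight_space V)"
    and weight_half_integral: "weight_space V n \<noteq> {0} \<Longrightarrow> 2 * n \<in> \<int>"
    and conf_weight: "conf V \<in> weight_space V 2"
    and weight_finite_dim: "\<exists>B. finite B \<and> weight_space V n = span B"
    and weight_bounded_below: "\<exists>N. \<forall>n<N. weight_space V n = {0}"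
    and translation: "Vir V (-1) v = mode V v (-2) (vac V)"

definition bipart :: "('a::ab_group_add, 'm) dg_voa_scheme \<Rightarrow> int \<Rightarrow> real \<Rightarrow> 'a set" where
  "bipart V p n = weight_space V n \<inter> deg_part V p"

definition bicomponent :: "('a::ab_group_add, 'm) dg_voa_scheme \<Rightarrow> int \<Rightarrow> real \<Rightarrow> 'a \<Rightarrow> 'a" where
  "bicomponent V p n = component (\<lambda>(q, m). bipart V q m) (p, n)"


section \<open>Weight graded dg Poisson algebras\<close>

record 'b bigraded_poisson = "(complex, 'b) module" +
  bracket :: "'b \<Rightarrow> 'b \<Rightarrow> 'b"
  differential :: "'b \<Rightarrow> 'b"
  part :: "int \<Rightarrow> real \<Rightarrow> 'b set"

text \<open>
  \<open>part A p n\<close> consists of the elements of cohomological degree \<open>p\<close> and weight \<open>n\<close>.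
  The bracket has degree \<open>-2\<close> and weight \<open>-1\<close>.  The signed identities are bilinear or
  trilinear, so they are only required for bihomogeneous elements.  The product need not be
  graded commutative.
\<close>

locale weight_graded_dg_poisson_algebra =
  Module.module "ring_of_type_algebra :: complex ring" A + ring A
  for A :: "('b, 'm) bigraded_poisson_scheme" (structure) +
  assumes smult_mult_left:
      "\<lbrakk>x \<in> carrier A; y \<in> carrier A\<rbrakk> \<Longrightarrow> (c \<odot> x) \<otimes> y = c \<odot> (x \<otimes> y)"
    and smult_mult_right:
      "\<lbrakk>x \<in> carrier A; y \<in> carrier A\<rbrakk> \<Longrightarrow> x \<otimes> (c \<odot> y) = c \<odot> (x \<otimes> y)"
    and bracket_closed: "\<lbrakk>x \<in> carrier A; y \<in> carrier A\<rbrakk> \<Longrightarrow> bracket A x y \<in> carrier A"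
    and bracket_add_left:
      "\<lbrakk>x \<in> carrier A; y \<in> carrier A; z \<in> carrier A\<rbrakk> \<Longrightarrow>
        bracket A (x \<oplus> y) z = bracket A x z \<oplus> bracket A y z"
    and bracket_add_right:
      "\<lbrakk>x \<in> carrier A; y \<in> carrier A; z \<in> carrier A\<rbrakk> \<Longrightarrow>
        bracket A x (y \<oplus> z) = bracket A x y \<oplus> bracket A x z"
    and bracket_smult_left:
      "\<lbrakk>x \<in> carrier A; y \<in> carrier A\<rbrakk> \<Longrightarrow> bracket A (c \<odot> x) y = c \<odot> bracket A x y"
    and bracket_smult_right:
      "\<lbrakk>x \<in> carrier A; y \<in> carrier A\<rbrakk> \<Longrightarrow> bracket A x (c \<odot> y) = c \<odot> bracket A x y"
    and differential_closed: "x \<in> carrier A \<Longrightarrow> differential A x \<in> carrier A"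
    and differential_add:
      "\<lbrakk>x \<in> carrier A; y \<in> carrier A\<rbrakk> \<Longrightarrow>
        differential A (x \<oplus> y) = differential A x \<oplus> differential A y"
    and differential_smult:
      "x \<in> carrier A \<Longrightarrow> differential A (c \<odot> x) = c \<odot> differential A x"
    and part_submodule: "submodule (part A p n) (ring_of_type_algebra :: complex ring) A"
    and part_half_integral: "part A p n \<noteq> {\<zero>} \<Longrightarrow> 2 * n \<in> \<int>"
    and part_direct_sum:
      "x \<in> carrier A \<Longrightarrow>
        \<exists>!f. (\<forall>p n. f (p, n) \<in> part A p n) \<and> finite {i. f i \<noteq> \<zero>} \<and>
             x = (\<Oplus>i\<in>{i. f i \<noteq> \<zero>}. f i)"
    and one_part: "\<one> \<in> part A 0 0"
    and mult_part:
      "\<lbrakk>x \<in> part A p m; y \<in> part A q n\<rbrakk> \<Longrightarrow> x \<otimes> y \<in> part A (p + q) (m + n)"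
    and bracket_part:
      "\<lbrakk>x \<in> part A p m; y \<in> part A q n\<rbrakk> \<Longrightarrow> bracket A x y \<in> part A (p + q - 2) (m + n - 1)"
    and differential_part: "x \<in> part A p n \<Longrightarrow> differential A x \<in> part A (p + 1) n"
    and differential_differential: "x \<in> carrier A \<Longrightarrow> differential A (differential A x) = \<zero>"
    and differential_mult:
      "\<lbrakk>x \<in> part A p m; y \<in> part A q n\<rbrakk> \<Longrightarrow>
        differential A (x \<otimes> y) =
          (differential A x \<otimes> y) \<oplus> (sgn_pow p \<odot> (x \<otimes> differential A y))"
    and bracket_skew:
      "\<lbrakk>x \<in> part A p m; y \<in> part A q n\<rbrakk> \<Longrightarrow>
        bracket A x y = \<ominus> (sgn_pow (p * q) \<odot> bracket A y x)"
    and bracket_jacobi: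
      "\<lbrakk>x \<in> part A p k; y \<in> part A q m; z \<in> part A r n\<rbrakk> \<Longrightarrow>
        bracket A x (bracket A y z) =
          bracket A (bracket A x y) z \<oplus> (sgn_pow (p * q) \<odot> bracket A y (bracket A x z))"
    and bracket_mult:
      "\<lbrakk>x \<in> part A p k; y \<in> part A q m; z \<in> part A r n\<rbrakk> \<Longrightarrow>
        bracket A x (y \<otimes> z) =
          (bracket A x y \<otimes> z) \<oplus> (sgn_pow (p * q) \<odot> (y \<otimes> bracket A x z))"
    and differential_bracket:
      "\<lbrakk>x \<in> part A p m; y \<in> part A q n\<rbrakk> \<Longrightarrow>
        differential A (bracket A x y) =
          bracket A (differential A x) y \<oplus> (sgn_pow p \<odot> bracket A x (differential A y))"

locale weight_graded_dg_poisson_hom =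
  src: weight_graded_dg_poisson_algebra A + tgt: weight_graded_dg_poisson_algebra B
  for A :: "('b, 'm) bigraded_poisson_scheme" and B :: "('c, 'n) bigraded_poisson_scheme"
  and h :: "'b \<Rightarrow> 'c" +
  assumes hom_ring: "h \<in> ring_hom A B"
    and hom_smult: "x \<in> carrier A \<Longrightarrow> h (c \<odot>\<^bsub>A\<^esub> x) = c \<odot>\<^bsub>B\<^esub> h x"
    and hom_part: "x \<in> part A p n \<Longrightarrow> h x \<in> part B p n"
    and hom_differential: "x \<in> carrier A \<Longrightarrow> h (differential A x) = differential B (h x)"
    and hom_bracket:
      "\<lbrakk>x \<in> carrier A; y \<in> carrier A\<rbrakk> \<Longrightarrow> h (bracket A x y) = bracket B (h x) (h y)"


section \<open>The algebra $R(V)$\<close>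

definition C2 :: "('a::ab_group_add, 'm) dg_voa_scheme \<Rightarrow> 'a set" where
  "C2 V = module.span (scl V) {mode V u (-2) v |u v. True}"

text \<open>
  Operations on cosets are unions over all representatives, as for \<open>rcoset_mult\<close> in HOL-Algebra:
  the result is a single coset exactly if it does not depend on the representatives.
\<close>

definition C2_algebra :: "('a::ab_group_add, 'm) dg_voa_scheme \<Rightarrow> 'a set bigraded_poisson" where
  "C2_algebra V = \<lparr>
     carrier = range (\<lambda>u. u +o C2 V),
     monoid.mult = (\<lambda>S T. \<Union>u\<in>S. \<Union>v\<in>T. mode V u (-1) v +o C2 V),
     one = vac V +o C2 V,
     ring.zero = C2 V,
     ring.add = (\<lambda>S T. \<Union>u\<in>S. \<Union>v\<in>T. (u + v) +o C2 V),
     module.smult = (\<lambda>c S. \<Union>u\<in>S. scl V c u +o C2 V),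
     bracket = (\<lambda>S T. \<Union>u\<in>S. \<Union>v\<in>T. mode V u 0 v +o C2 V),
     differential = (\<lambda>S. \<Union>u\<in>S. codiff V u +o C2 V),
     part = (\<lambda>p n. (\<lambda>u. u +o C2 V) ` bipart V p n)\<rparr>"


section \<open>The bigraded algebra associated to the Zhu algebra\<close>

definition zhu_mult :: "('a::ab_group_add, 'm) dg_voa_scheme \<Rightarrow> 'a \<Rightarrow> 'a \<Rightarrow> 'a" where
  "zhu_mult V u v = Sum_any (\<lambda>w::real. Sum_any (\<lambda>n::nat.
     scl V (of_real w gchoose n) (mode V (component (weight_space V) w u) (int n - 1) v)))"

definition zhu_circ :: "('a::ab_group_add, 'm) dg_voa_scheme \<Rightarrow> 'a \<Rightarrow> 'a \<Rightarrow> 'a" where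
  "zhu_circ V u v = Sum_any (\<lambda>w::real. Sum_any (\<lambda>n::nat.
     scl V (of_real w gchoose n) (mode V (component (weight_space V) w u) (int n - 2) v)))"

definition zhu_O :: "('a::ab_group_add, 'm) dg_voa_scheme \<Rightarrow> 'a set" where
  "zhu_O V = module.span (scl V) {zhu_circ V u v |u v. True}"

text \<open>The subspace $I_n^{[p]}$.\<close>

definition gr_null :: "('a::ab_group_add, 'm) dg_voa_scheme \<Rightarrow> int \<Rightarrow> real \<Rightarrow> 'a set" where
  "gr_null V p n = zhu_O V
     + module.span (scl V) (\<Union>{bipart V q m |q m. q \<le> p \<and> m < n})
     + module.span (scl V) (\<Union>{bipart V q m |q m. q < p \<and> m \<le> n})"

definition gr_carrier :: "('a::ab_group_add, 'm) dg_voa_scheme \<Rightarrow> (int \<times> real \<Rightarrow> 'a set) set" where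
  "gr_carrier V =
     {F. (\<forall>p n. F (p, n) \<in> (\<lambda>u. u +o gr_null V p n) ` bipart V p n) \<and>
         finite {(p, n). F (p, n) \<noteq> gr_null V p n}}"

text \<open>
  An element of the direct sum is represented by the vectors of \<open>V\<close> whose bihomogeneous
  components represent its components.
\<close>

definition gr_reps :: "('a::ab_group_add, 'm) dg_voa_scheme \<Rightarrow> (int \<times> real \<Rightarrow> 'a set) \<Rightarrow> 'a set" where
  "gr_reps V F = {x. \<forall>p n. bicomponent V p n x \<in> F (p, n)}"

definition gr_class :: "('a::ab_group_add, 'm) dg_voa_scheme \<Rightarrow> 'a \<Rightarrow> int \<times> real \<Rightarrow> 'a set" where
  "gr_class V x = (\<lambda>(p, n). bicomponent V p n x +o gr_null V p n)"

text \<open>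
  \<open>gr_mult_comp V x y p n\<close> collects the products of those bihomogeneous components of \<open>x\<close> and
  \<open>y\<close> that contribute to degree \<open>p\<close> and weight \<open>n\<close>.  The terms of \<open>gr_bracket_comp\<close> pair
  degrees \<open>p1\<close>, \<open>p2\<close> with \<open>p1 + p2 - 2 = p\<close> and weights \<open>n1\<close>, \<open>n2\<close> with \<open>n1 + n2 - 1 = n\<close>.
\<close>

definition gr_mult_comp ::
  "('a::ab_group_add, 'm) dg_voa_scheme \<Rightarrow> 'a \<Rightarrow> 'a \<Rightarrow> int \<Rightarrow> real \<Rightarrow> 'a" where
  "gr_mult_comp V x y p n = Sum_any (\<lambda>(p1, n1).
     zhu_mult V (bicomponent V p1 n1 x) (bicomponent V (p - p1) (n - n1) y))"

definition gr_bracket_comp ::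
  "('a::ab_group_add, 'm) dg_voa_scheme \<Rightarrow> 'a \<Rightarrow> 'a \<Rightarrow> int \<Rightarrow> real \<Rightarrow> 'a" where
  "gr_bracket_comp V x y p n = Sum_any (\<lambda>(p1, n1).
     let p2 = p + 2 - p1; n2 = n + 1 - n1;
         u = bicomponent V p1 n1 x; v = bicomponent V p2 n2 y
     in zhu_mult V u v - scl V (sgn_pow (p1 * p2)) (zhu_mult V v u))"

definition gr_zhu_algebra ::
  "('a::ab_group_add, 'm) dg_voa_scheme \<Rightarrow> (int \<times> real \<Rightarrow> 'a set) bigraded_poisson" where
  "gr_zhu_algebra V = \<lparr>
     carrier = gr_carrier V,
     monoid.mult = (\<lambda>F G (p, n). \<Union>x\<in>gr_reps V F. \<Union>y\<in>gr_reps V G.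
       gr_mult_comp V x y p n +o gr_null V p n),
     one = gr_class V (vac V),
     ring.zero = (\<lambda>(p, n). gr_null V p n),
     ring.add = (\<lambda>F G (p, n). \<Union>u\<in>F (p, n). \<Union>v\<in>G (p, n). (u + v) +o gr_null V p n),
     module.smult = (\<lambda>c F (p, n). \<Union>u\<in>F (p, n). scl V c u +o gr_null V p n),
     bracket = (\<lambda>F G (p, n). \<Union>x\<in>gr_reps V F. \<Union>y\<in>gr_reps V G.
       gr_bracket_comp V x y p n +o gr_null V p n),
     differential = (\<lambda>F (p, n). \<Union>u\<in>F (p - 1, n) \<inter> bipart V (p - 1) n.
       codiff V u +o gr_null V p n),
     part = (\<lambda>p n. {F \<in> gr_carrier V. \<forall>q m. (q, m) \<noteq> (p, n) \<longrightarrow> F (q, m) = gr_null V q m})\<rparr>"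


section \<open>The map $\eta$\<close>

definition gr_single ::
  "('a::ab_group_add, 'm) dg_voa_scheme \<Rightarrow> int \<Rightarrow> real \<Rightarrow> 'a \<Rightarrow> int \<times> real \<Rightarrow> 'a set" where
  "gr_single V p n u =
     (\<lambda>(q, m). if (q, m) = (p, n) then u +o gr_null V p n else gr_null V q m)"

text \<open>The linear extension of $u + C_2 \mapsto u + I_n^{[p]}$ for $u \in V_n^{[p]}$.\<close>

definition eta :: "('a::ab_group_add, 'm) dg_voa_scheme \<Rightarrow> 'a set \<Rightarrow> int \<times> real \<Rightarrow> 'a set" where
  "eta V S = (\<lambda>(p, n). \<Union>x\<in>S. gr_class V x (p, n))"

end

theory Submission
  imports Defs "HOL-Computational_Algebra.Formal_Power_Series"
begin

text \<open>
  Both algebras are quotients of $V$ itself.  The first is $V/C_2(V)$.  The second is $V/K$, where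
  \<open>gr_kernel\<close> $K = \bigoplus_{p,n} (V_n^{[p]} \cap I_n^{[p]})$, because a family of classes of
  bihomogeneous vectors is the same as the class of their sum.  For bihomogeneous $u$ and $v$ the
  series defining the Zhu operations drop in degree and weight from each term to the next, so modulo
  lower terms $u \ast v$ is $u_{-1}v$ and $u \circ v$ is $u_{-2}v$.  Zhu's commutator formula
  \[ u \ast v - (-1)^{|u||v|} v \ast u \equiv \operatorname{Res}_x (1+x)^{\operatorname{wt}(u)-1} Y(u,x)v
     \pmod{O(V)} \]
  shows that the commutator has leading term $u_0v$.  Hence $C_2(V) \subseteq K$, and the product,
  bracket and differential of both quotients are induced by the same operations $u_{-1}v$, $u_0v$ and
  $d_Vv$ on $V$.  The map $\eta$ is the projection $V/C_2(V) \to V/K$, which makes it surjective and a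
  morphism as soon as the operations descend to both quotients.

  That they descend to $V/K$ is the substance of the proof.  By skew symmetry right and left
  operations agree up to sign modulo $C_2(V)$ (\<open>mode_right_closed\<close>), so it is enough to multiply $K$ from
  the left.  The leading terms reduce this to two closure properties of $O(V)$: it is mapped to itself
  by $u \ast {}$ (\<open>zhu_mult_zhu_O\<close>) and by the derivation
  $\operatorname{Res}_x (1+x)^{\operatorname{wt}(u)-1} Y(u,x)$ (\<open>zhu_derivation_zhu_O\<close>).
  Both follow from one commutator formula for residues of fields against power series
  (\<open>residue_commutator\<close>).  All of these are identities between formal binomial series with an
  arbitrary complex exponent, so half-integral weights are covered.

  The Poisson axioms hold on any quotient of $V$ by a bigraded subspace that contains $C_2(V)$ and to
  which the operations descend (\<open>poisson_quotient\<close>).  Leibniz rule and Jacobi identity are instances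
  of the commutator formula for modes, skew symmetry and associativity hold modulo $C_2(V)$.
\<close>

section \<open>Direct sums and finitely supported families\<close>

lemma Sum_any_single:
  assumes "\<And>i. i \<noteq> j \<Longrightarrow> f i = 0"
  shows "Sum_any f = f j"
proof -
  have "{i. f i \<noteq> 0} \<subseteq> {j}" using assms by auto
  then show ?thesis by (simp add: Sum_any.expand_superset[of "{j}"])
qed

lemma Sum_any_atLeast0:
  fixes f :: "nat \<Rightarrow> 'a::comm_monoid_add"
  assumes "\<And>i. i \<ge> N \<Longrightarrow> f i = 0"
  shows "Sum_any f = sum f {..<N}"
proof (rule Sum_any.expand_superset)
  show "{i. f i \<noteq> 0} \<subseteq> {..<N}" using assms linorder_not_less by blast
qed simp

lemma component_eq:
  assumes "is_direct_sum W" "decomposition W v f"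
  shows "component W i v = f i"
  using assms unfolding is_direct_sum_def component_def by (simp add: the1_equality)

lemma decomposition_component:
  assumes "is_direct_sum W"
  shows "decomposition W v (\<lambda>i. component W i v)"
  using assms unfolding is_direct_sum_def component_def by (metis theI')

lemma decomposition_single:
  assumes "x \<in> W j" "\<And>i. 0 \<in> W i"
  shows "decomposition W x (\<lambda>i. if i = j then x else 0)"
  using assms by (auto simp: decomposition_def)

lemma component_single:
  assumes "is_direct_sum W" "x \<in> W j" "\<And>i. 0 \<in> W i"
  shows "component W i x = (if i = j then x else 0)"
  by (rule component_eq[OF assms(1) decomposition_single]) (use assms in auto)

lemma decomposition_add:
  assumes "decomposition W x f" "decomposition W y g"
    and "\<And>i a b. a \<in> W i \<Longrightarrow> b \<in> W i \<Longrightarrow> a + b \<in> W i"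
  shows "decomposition W (x + y) (\<lambda>i. f i + g i)"
proof -
  have "{i. f i + g i \<noteq> 0} \<subseteq> {i. f i \<noteq> 0} \<union> {i. g i \<noteq> 0}" by auto
  with assms show ?thesis
    by (auto simp: decomposition_def Sum_any.distrib intro: finite_subset)
qed

lemma direct_sum_induct:
  assumes "is_direct_sum W" "\<And>i. 0 \<in> W i"
    and "\<And>i x. x \<in> W i \<Longrightarrow> P x" "\<And>x y. P x \<Longrightarrow> P y \<Longrightarrow> P (x + y)"
  shows "P x"
proof -
  let ?g = "\<lambda>i. component W i x"
  have "decomposition W x ?g" by (rule decomposition_component[OF assms(1)])
  then have fin: "finite {i. ?g i \<noteq> 0}" and W: "\<And>i. ?g i \<in> W i" and x: "x = sum ?g {i. ?g i \<noteq> 0}"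
    by (auto simp: decomposition_def Sum_any.expand_set)
  have P: "P (?g i)" for i using W assms(3) by blast
  have "P 0" using assms(2,3) by blast
  have "P (sum ?g S)" if "finite S" for S
    using that by (induction S rule: finite_induct) (auto intro: \<open>P 0\<close> assms(4) P)
  then show ?thesis using fin x by metis
qed

context vector_space
begin

lemma linearI:
  assumes "\<And>x y. f (x + y) = f x + f y" "\<And>c x. f (scale c x) = scale c (f x)"
  shows "Vector_Spaces.linear scale scale f"
  using assms by unfold_locales auto

lemma decomposition_scale:
  assumes "decomposition W x f" "\<And>i. subspace (W i)"
  shows "decomposition W (scale c x) (\<lambda>i. scale c (f i))"
proof -
  have "{i. scale c (f i) \<noteq> 0} \<subseteq> {i. f i \<noteq> 0}" by auto
  with assms show ?thesis
    by (auto simp: decomposition_def Sum_any.expand_superset[of "{i. f i \<noteq> 0}"] scale_sum_right subspace_scale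
        intro: finite_subset)
qed

lemma component_linear:
  assumes "is_direct_sum W" "\<And>i. subspace (W i)"
  shows "Vector_Spaces.linear scale scale (component W i)"
proof (rule linearI)
  fix x y c
  show "component W i (x + y) = component W i x + component W i y"
    by (rule component_eq[OF assms(1)], rule decomposition_add)
      (use assms in \<open>auto intro: decomposition_component subspace_add\<close>)
  show "component W i (scale c x) = scale c (component W i x)"
    by (rule component_eq[OF assms(1)], rule decomposition_scale)
      (use assms in \<open>auto intro: decomposition_component\<close>)
qed

lemma span_linear_into:
  assumes "Vector_Spaces.linear scale scale f" "subspace S" "\<And>x. x \<in> B \<Longrightarrow> f x \<in> S" "x \<in> span B"
  shows "f x \<in> S"
proof -
  interpret f: Vector_Spaces.linear scale scale f by fact
  have "subspace (f -` S)"
    using assms(2) by (auto simp: subspace_def f.add f.scale)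
  moreover have "B \<subseteq> f -` S" using assms(3) by auto
  ultimately have "span B \<subseteq> f -` S" by (simp add: span_minimal)
  with assms(4) show ?thesis by auto
qed

text \<open>
  Both sides are the components of $f(v) = cv$, which has only one decomposition.
\<close>

lemma component_eigenvector:
  assumes "is_direct_sum W" "\<And>i. subspace (W i)" "Vector_Spaces.linear scale scale f"
    and "\<And>i x. x \<in> W i \<Longrightarrow> f x \<in> W i" "f v = scale c v"
  shows "f (component W i v) = scale c (component W i v)"
proof -
  interpret f: Vector_Spaces.linear scale scale f by fact
  let ?g = "\<lambda>i. component W i v"
  have dec: "decomposition W v ?g" by (rule decomposition_component[OF assms(1)])
  let ?S = "{i. ?g i \<noteq> 0}"
  have S: "finite ?S" using dec by (simp add: decomposition_def)
  have v: "v = sum ?g ?S" using dec by (simp add: decomposition_def Sum_any.expand_set)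
  have sub: "{i. f (?g i) \<noteq> 0} \<subseteq> ?S" by auto
  have "decomposition W (f v) (\<lambda>i. f (?g i))"
    unfolding decomposition_def
  proof (intro conjI allI)
    show "f (?g i) \<in> W i" for i using dec assms(4) by (simp add: decomposition_def)
    show "finite {i. f (?g i) \<noteq> 0}" using finite_subset[OF sub S] .
    have "f v = (\<Sum>i\<in>?S. f (?g i))" by (subst v) (simp add: f.sum)
    then show "f v = (\<Sum>i. f (?g i))" by (simp add: Sum_any.expand_superset[OF S sub])
  qed
  moreover have "decomposition W (f v) (\<lambda>i. scale c (?g i))"
    using decomposition_scale[OF dec assms(2)] assms(5) by simp
  ultimately show ?thesis using component_eq[OF assms(1)] by metis
qed

end

section \<open>Signs\<close>

lemma sgn_pow_0 [simp]: "sgn_pow 0 = 1"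
  and sgn_pow_1 [simp]: "sgn_pow 1 = -1"
  by (simp_all add: sgn_pow_def)

lemma sgn_pow_add: "sgn_pow (a + b) = sgn_pow a * sgn_pow b"
  by (simp add: sgn_pow_def power_int_add)

lemma sgn_pow_even [simp]: "even k \<Longrightarrow> sgn_pow k = 1"
  by (simp add: sgn_pow_def)

lemma sgn_pow_odd: "odd k \<Longrightarrow> sgn_pow k = -1"
  by (simp add: sgn_pow_def)

lemma sgn_pow_square [simp]: "sgn_pow k * sgn_pow k = 1"
  by (cases "even k") (auto simp: sgn_pow_odd)

lemma sgn_pow_of_nat: "sgn_pow (int n) = (-1) ^ n"
  by (simp add: sgn_pow_def)

section \<open>Consequences of the Jacobi identity\<close>

context dg_vertex_algebra
begin

abbreviation lin :: "('a \<Rightarrow> 'a) \<Rightarrow> bool" where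
  "lin \<equiv> Vector_Spaces.linear (scl V) (scl V)"

sublocale mode_right: Vector_Spaces.linear "scl V" "scl V" "mode V u n" for u n
  by (rule mode_linear_right)

sublocale mode_left: Vector_Spaces.linear "scl V" "scl V" "\<lambda>u. mode V u n w" for n w
  by (rule mode_linear_left)

sublocale d: Vector_Spaces.linear "scl V" "scl V" "codiff V"
  by (rule codiff_linear)

lemma finite_nonzero_modes:
  "\<exists>N. \<forall>n::nat. n \<ge> N \<longrightarrow> mode V u (int n - k) v = 0"
proof -
  obtain N where N: "\<forall>n\<ge>N. mode V u n v = 0" using truncation by blast
  have "mode V u (int n - k) v = 0" if "n \<ge> nat (N + k)" for n
    using N that by (simp add: nat_le_iff)
  then show ?thesis by blast
qed

lemma commutator:
  assumes "u \<in> deg_part V p" "v \<in> deg_part V q"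
  shows "mode V u m (mode V v n w) - scl V (sgn_pow (p * q)) (mode V v n (mode V u m w))
    = Sum_any (\<lambda>i. scl V (of_int m gchoose i) (mode V (mode V u (int i) v) (m + n - int i) w))"
proof -
  have "Sum_any (\<lambda>i::nat. scl V ((-1) ^ i * (of_int 0 gchoose i))
          (mode V u (m + 0 - int i) (mode V v (n + int i) w)
           - scl V (sgn_pow 0 * sgn_pow (p * q))
               (mode V v (n + 0 - int i) (mode V u (m + int i) w))))
    = mode V u m (mode V v n w) - scl V (sgn_pow (p * q)) (mode V v n (mode V u m w))"
    by (subst Sum_any_single[of 0]) (auto simp: gr0_conv_Suc)
  then show ?thesis using jacobi[OF assms, of 0 m n w] by simp
qed

text \<open>In the Jacobi identity with $v = 1$, $l = -2$ and $m = 0$ at most one term on either side is nonzero.\<close>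

lemma mode_translate_homogeneous:
  assumes "u \<in> deg_part V p"
  shows "mode V (mode V u (-2) (vac V)) n w = scl V (- of_int n) (mode V u (n - 1) w)"
proof -
  have coeff: "(-1) ^ i * ((-2 :: complex) gchoose i) = of_nat (Suc i)" for i
  proof -
    have "(2 :: complex) + of_nat i - 1 = of_nat (Suc i)" by simp
    then have "((-2 :: complex) gchoose i) = (-1) ^ i * of_nat (Suc i choose i)"
      using gbinomial_minus[of "2::complex" i] by (simp only: binomial_gbinomial)
    moreover have "((-1) ^ i * (-1) ^ i :: complex) = 1" by (simp flip: power_add)
    ultimately show ?thesis by (simp only: binomial_Suc_n mult.assoc[symmetric] mult_1)
  qed
  have R: "Sum_any (\<lambda>i::nat. scl V (of_int 0 gchoose i)
            (mode V (mode V u (-2 + int i) (vac V)) (0 + n - int i) w))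
      = mode V (mode V u (-2) (vac V)) n w"
    by (subst Sum_any_single[of 0]) (auto simp: gr0_conv_Suc)
  have L: "Sum_any (\<lambda>i::nat. scl V ((-1) ^ i * (of_int (-2) gchoose i))
          (mode V u (0 + -2 - int i) (mode V (vac V) (n + int i) w)
           - scl V (sgn_pow (-2) * sgn_pow (p * 0))
               (mode V (vac V) (n + -2 - int i) (mode V u (0 + int i) w))))
      = scl V (- of_int n) (mode V u (n - 1) w)" (is "Sum_any ?f = _")
  proof -
    consider "n < 0" | "n = 0" | "n > 0" by linarith
    then show ?thesis
    proof cases
      case 1
      have "Sum_any ?f = ?f (nat (-1 - n))"
        by (rule Sum_any_single) (use 1 in \<open>auto simp: vac_mode\<close>)
      then show ?thesis using 1 by (simp add: coeff vac_mode algebra_simps del: of_nat_Suc) (simp add: algebra_simps)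
    next
      case 2
      have "?f i = 0" for i using 2 by (auto simp: vac_mode)
      then have "Sum_any ?f = 0" by (simp only: Sum_any.neutral)
      then show ?thesis using 2 by simp
    next
      case 3
      have "Sum_any ?f = ?f (nat (n - 1))"
        by (rule Sum_any_single) (use 3 in \<open>auto simp: vac_mode\<close>)
      then show ?thesis using 3 by (simp add: coeff vac_mode algebra_simps del: of_nat_Suc) (simp add: algebra_simps)
    qed
  qed
  show ?thesis using jacobi[OF assms vac_degree, of "-2" 0 n w] L R by simp
qed

lemmas deg_induct = direct_sum_induct[OF deg_direct_sum subspace_0[OF deg_subspace], case_names homogeneous add]

lemma mode_translate:
  "mode V (mode V u (-2) (vac V)) n w = scl V (- of_int n) (mode V u (n - 1) w)"
  by (induction u rule: deg_induct)
     (auto simp: mode_translate_homogeneous mode_left.add scale_right_distrib)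

text \<open>
  Apply the Jacobi identity to $w = 1$ with $m = -1$ and $n = 0$: the terms $v_i 1$ with $i \ge 0$ and
  $u_{i-1} 1$ with $i \ge 1$ vanish, which leaves $v_l u_{-1} 1 = v_l u$.
\<close>

lemma skew_symmetry:
  assumes "u \<in> deg_part V p" "v \<in> deg_part V q"
  shows "mode V v l u = scl V (sgn_pow (p * q) * sgn_pow (l + 1))
    (Sum_any (\<lambda>i. scl V ((-1) ^ i) (mode V (mode V u (l + int i) v) (-1 - int i) (vac V))))"
proof -
  have coeff: "((-1 :: complex) gchoose i) = (-1) ^ i" for i
    using gbinomial_minus[of "1::complex" i] by (simp flip: binomial_gbinomial)
  have L: "Sum_any (\<lambda>i::nat. scl V ((-1) ^ i * (of_int l gchoose i))
          (mode V u (-1 + l - int i) (mode V v (0 + int i) (vac V))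
           - scl V (sgn_pow l * sgn_pow (p * q))
               (mode V v (0 + l - int i) (mode V u (-1 + int i) (vac V)))))
      = - scl V (sgn_pow l * sgn_pow (p * q)) (mode V v l u)"
    by (subst Sum_any_single[of 0]) (auto simp: creation_regular creation gr0_conv_Suc)
  have "mode V v l u = scl V (sgn_pow (p * q) * sgn_pow (l + 1))
      (- scl V (sgn_pow l * sgn_pow (p * q)) (mode V v l u))"
    by (simp add: sgn_pow_add mult_ac)
  also have "- scl V (sgn_pow l * sgn_pow (p * q)) (mode V v l u)
      = Sum_any (\<lambda>i. scl V ((-1) ^ i) (mode V (mode V u (l + int i) v) (-1 - int i) (vac V)))"
    using jacobi[OF assms, of l "-1" 0 "vac V"] unfolding L by (simp add: coeff)
  finally show ?thesis .
qed

text \<open>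
  The Jacobi identity with $l = n = -1$ and $m = 0$.
\<close>

lemma iterate_product:
  assumes "u \<in> deg_part V p" "v \<in> deg_part V q"
  shows "mode V (mode V u (-1) v) (-1) w = Sum_any (\<lambda>i::nat. mode V u (-1 - int i) (mode V v (-1 + int i) w)
      + scl V (sgn_pow (p * q)) (mode V v (-2 - int i) (mode V u (int i) w)))"
proof -
  have coeff: "((-1 :: complex) gchoose i) = (-1) ^ i" for i
    using gbinomial_minus[of "1::complex" i] by (simp flip: binomial_gbinomial)
  have "Sum_any (\<lambda>i::nat. scl V (of_int 0 gchoose i)
            (mode V (mode V u (-1 + int i) v) (0 + -1 - int i) w)) = mode V (mode V u (-1) v) (-1) w"
    by (subst Sum_any_single[of 0]) (auto simp: gr0_conv_Suc)
  then show ?thesis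
    using jacobi[OF assms, of "-1" 0 "-1" w] by (simp add: coeff sgn_pow_odd flip: power_add mult_2)
qed

end

section \<open>Weights\<close>

context dg_vertex_operator_algebra
begin

lemma Vir_0: "Vir V 0 = mode V (conf V) 1"
  by (simp add: Vir_def)

lemma weight_subspace: "subspace (weight_space V n)"
  by (auto simp: weight_space_def Vir_0 subspace_def mode_right.add mode_right.scale
      scale_right_distrib scale_left_commute)

lemma zero_in_weight_space [simp]: "0 \<in> weight_space V n"
  by (simp add: weight_subspace subspace_0)

lemma zero_in_deg_part [simp]: "0 \<in> deg_part V n"
  by (simp add: deg_subspace subspace_0)

text \<open>
  The commutator of $L(0) = \omega_1$ with $u_n$ has only the two terms $(\omega_0 u)_{n+1}$ and
  $(\omega_1 u)_n$, and $\omega_0 u = L(-1)u$.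
\<close>

lemma Vir_0_mode:
  "Vir V 0 (mode V u n w) = mode V u n (Vir V 0 w) + mode V (Vir V 0 u) n w - scl V (of_int (n + 1)) (mode V u n w)"
proof (induction u rule: deg_induct)
  case (homogeneous p u)
  have "Vir V 0 (mode V u n w) - mode V u n (Vir V 0 w)
      = Sum_any (\<lambda>i. scl V (1 gchoose i) (mode V (mode V (conf V) (int i) u) (1 + n - int i) w))"
    using commutator[OF conf_degree homogeneous, of 1 n w] by (simp add: Vir_0)
  also have "\<dots> = (\<Sum>i<2. scl V (1 gchoose i) (mode V (mode V (conf V) (int i) u) (1 + n - int i) w))"
  proof (rule Sum_any_atLeast0)
    fix i :: nat assume "i \<ge> 2"
    then have "((1 :: complex) gchoose i) = 0" using binomial_gbinomial[of 1 i, where 'a = complex] by (simp add: binomial_eq_0)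
    then show "scl V (1 gchoose i) (mode V (mode V (conf V) (int i) u) (1 + n - int i) w) = 0" by simp
  qed
  also have "\<dots> = mode V (mode V (conf V) 0 u) (1 + n) w + mode V (Vir V 0 u) n w"
    by (simp add: Vir_0 numeral_2_eq_2)
  also have "mode V (conf V) 0 u = mode V u (-2) (vac V)"
    using translation[of u] by (simp add: Vir_def)
  finally show ?case by (simp add: mode_translate scale_left_distrib algebra_simps)
next
  case (add x y)
  have "Vir V 0 (a + b) = Vir V 0 a + Vir V 0 b" for a b by (simp add: Vir_0 mode_right.add)
  then show ?case by (simp only: mode_left.add scale_right_distrib add.IH) (simp add: algebra_simps)
qed

lemma mode_weight:
  assumes "u \<in> weight_space V a" "v \<in> weight_space V b"
  shows "mode V u n v \<in> weight_space V (a + b - of_int n - 1)"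
  using assms unfolding weight_space_def
  by (simp add: Vir_0_mode mode_right.scale mode_left.scale scale_left_distrib scale_left_diff_distrib algebra_simps)

lemma vac_weight: "vac V \<in> weight_space V 0"
  by (simp add: weight_space_def Vir_0 creation_regular)

lemma codiff_weight:
  assumes "v \<in> weight_space V n" shows "codiff V v \<in> weight_space V n"
  using assms mode_codiff[OF conf_degree, of 1 v]
  by (simp add: weight_space_def Vir_0 codiff_conf d.scale)

section \<open>Bihomogeneous components\<close>

lemma bipartI: "v \<in> weight_space V n \<Longrightarrow> v \<in> deg_part V p \<Longrightarrow> v \<in> bipart V p n"
  and bipart_weight: "v \<in> bipart V p n \<Longrightarrow> v \<in> weight_space V n"
  and bipart_degree: "v \<in> bipart V p n \<Longrightarrow> v \<in> deg_part V p"
  by (auto simp: bipart_def)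

lemma bipart_subspace: "subspace (bipart V p n)"
  unfolding bipart_def by (intro subspace_inter weight_subspace deg_subspace)

lemma zero_in_bipart [simp]: "0 \<in> bipart V p n"
  by (simp add: bipart_subspace subspace_0)

lemma bipart_mode:
  assumes "u \<in> bipart V p a" "v \<in> bipart V q b"
  shows "mode V u n v \<in> bipart V (p + q - 2 * n - 2) (a + b - of_int n - 1)"
  using assms mode_weight[of u a v b n] mode_degree[of u p v q n] by (auto simp: bipart_def algebra_simps)

lemma bipart_codiff:
  assumes "u \<in> bipart V p a" shows "codiff V u \<in> bipart V (p + 1) a"
  using assms codiff_weight codiff_degree by (auto simp: bipart_def)

lemma bipart_vac: "vac V \<in> bipart V 0 0"
  using vac_weight vac_degree by (simp add: bipart_def)

text \<open>Since $L(0)$ has degree $0$, the weight decomposition refines the degree decomposition.\<close>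

lemma bipart_direct_sum: "is_direct_sum (\<lambda>(q, m). bipart V q m)" (is "is_direct_sum ?W")
  unfolding is_direct_sum_def
proof
  fix v
  let ?h = "component (deg_part V)" and ?g = "component (weight_space V)"
  interpret dg: Vector_Spaces.linear "scl V" "scl V" "?h p" for p
    by (rule component_linear[OF deg_direct_sum deg_subspace])
  interpret wt: Vector_Spaces.linear "scl V" "scl V" "?g n" for n
    by (rule component_linear[OF weight_direct_sum weight_subspace])
  have L0: "Vir V 0 x \<in> deg_part V p" if "x \<in> deg_part V p" for x p
    using mode_degree[OF conf_degree that, of 1] by (simp add: Vir_0)
  have plus: "decomposition ?W (x + y) (\<lambda>i. f i + g i)" if "decomposition ?W x f" "decomposition ?W y g" for x y f g
    by (rule decomposition_add[OF that]) (auto intro: subspace_add bipart_subspace)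
  have ex: "\<exists>f. decomposition ?W x f" for x
  proof (induction x rule: direct_sum_induct[OF weight_direct_sum zero_in_weight_space])
    case (1 n x)
    have "Vir V 0 (?h i x) = scl V (of_real n) (?h i x)" for i
    proof (rule component_eigenvector[OF deg_direct_sum deg_subspace])
      show "lin (Vir V 0)" by (simp add: Vir_0 mode_linear_right)
      show "Vir V 0 x = scl V (of_real n) x" using 1 by (simp add: weight_space_def)
    qed (rule L0)
    then have "?h i x \<in> weight_space V n" for i
      by (simp add: weight_space_def)
    moreover have "?h i x \<in> deg_part V i" for i
      using decomposition_component[OF deg_direct_sum, of x] by (simp add: decomposition_def)
    ultimately have bi: "?h i x \<in> ?W (i, n)" for i by (simp add: bipartI)
    have "\<exists>f. decomposition ?W (sum (\<lambda>i. ?h i x) S) f" if "finite S" for S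
      using that
    proof (induction S rule: finite_induct)
      case empty
      have "decomposition ?W 0 (\<lambda>i. 0)" by (auto simp: decomposition_def)
      then show ?case by auto
    next
      case (insert i S)
      have "decomposition ?W (?h i x) (\<lambda>j. if j = (i, n) then ?h i x else 0)"
        by (rule decomposition_single) (use bi in auto)
      with insert show ?case using plus by fastforce
    qed
    moreover have "x = sum (\<lambda>i. ?h i x) {i. ?h i x \<noteq> 0}" "finite {i. ?h i x \<noteq> 0}"
      using decomposition_component[OF deg_direct_sum, of x] by (auto simp: decomposition_def Sum_any.expand_set)
    ultimately show ?case by metis
  next
    case (2 x y)
    then show ?case using plus by blast
  qed
  have "f (p, n) = ?h p (?g n v)" if f: "decomposition ?W v f" for f p n
  proof -
    let ?S = "{i. f i \<noteq> 0}"
    have fin: "finite ?S" and v: "v = sum f ?S" and fW: "\<And>q m. f (q, m) \<in> bipart V q m"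
      using f by (auto simp: decomposition_def Sum_any.expand_set)
    have "?h p (?g n (f i)) = (if i = (p, n) then f i else 0)" for i
    proof (cases i)
      case (Pair q m)
      have "?g n (f i) = (if n = m then f i else 0)"
        by (rule component_single[OF weight_direct_sum]) (use fW Pair in \<open>auto simp: bipart_def\<close>)
      moreover have "?h p (f i) = (if p = q then f i else 0)"
        by (rule component_single[OF deg_direct_sum]) (use fW Pair in \<open>auto simp: bipart_def\<close>)
      moreover have "?h p 0 = 0"
        using component_single[OF deg_direct_sum, of 0 0 p] by simp
      ultimately show ?thesis using Pair by auto
    qed
    then have "?h p (?g n v) = (\<Sum>i\<in>?S. if i = (p, n) then f i else 0)"
      by (subst v) (simp add: wt.sum dg.sum)
    also have "\<dots> = f (p, n)" using fin by (auto simp: sum.delta)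
    finally show ?thesis by simp
  qed
  then have "f = g" if "decomposition ?W v f" "decomposition ?W v g" for f g
    using that by (intro ext) (metis surj_pair)
  with ex show "\<exists>!f. decomposition ?W v f" by blast
qed

lemma bipart_case_subspace: "subspace (case i of (q, m) \<Rightarrow> bipart V q m)"
  by (cases i) (simp add: bipart_subspace)

sublocale bic: Vector_Spaces.linear "scl V" "scl V" "bicomponent V p n" for p n
  unfolding bicomponent_def by (rule component_linear[OF bipart_direct_sum bipart_case_subspace])

lemma bicomponent_decomposition:
  "decomposition (\<lambda>(q, m). bipart V q m) x (\<lambda>(p, n). bicomponent V p n x)"
  using decomposition_component[OF bipart_direct_sum, of x]
  unfolding bicomponent_def by (simp add: case_prod_unfold)

lemma bicomponent_in: "bicomponent V p n x \<in> bipart V p n"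
  using bicomponent_decomposition[of x] by (auto simp: decomposition_def)

lemma finite_bicomponents: "finite {(p, n). bicomponent V p n x \<noteq> 0}"
  using bicomponent_decomposition[of x] by (auto simp: decomposition_def case_prod_unfold)

lemma bicomponent_sum: "(\<Sum>(p, n)\<in>{(p, n). bicomponent V p n x \<noteq> 0}. bicomponent V p n x) = x"
  using bicomponent_decomposition[of x] by (auto simp: decomposition_def Sum_any.expand_set case_prod_unfold)

lemma bicomponent_bipart:
  assumes "x \<in> bipart V q m"
  shows "bicomponent V p n x = (if p = q \<and> n = m then x else 0)"
  using component_single[OF bipart_direct_sum, of x "(q, m)" "(p, n)"] assms
  by (auto simp: bicomponent_def)

lemma bihom_induct [case_names bihom add]:
  assumes "\<And>p n x. x \<in> bipart V p n \<Longrightarrow> P x" "\<And>x y. P x \<Longrightarrow> P y \<Longrightarrow> P (x + y)"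
  shows "P x"
  by (rule direct_sum_induct[OF bipart_direct_sum, where P = P]) (use assms in auto)

text \<open>
  This lets statements about a bihomogeneous operator be checked one component at a time.
\<close>

lemma bicomponent_shift:
  assumes "lin f" "\<And>q m y. y \<in> bipart V q m \<Longrightarrow> f y \<in> bipart V (q + a) (m + b)"
  shows "bicomponent V p n (f x) = f (bicomponent V (p - a) (n - b) x)"
proof -
  interpret f: Vector_Spaces.linear "scl V" "scl V" f by fact
  show ?thesis
    by (induction x rule: bihom_induct)
      (auto simp: bicomponent_bipart[OF assms(2)] bicomponent_bipart f.add bic.add)
qed

end

section \<open>Residues of fields against power series\<close>

text \<open>This is $\operatorname{Res}_x f(x)\, x^{-k}\, Y(u,x) v$.\<close>

definition residue ::
  "('a::ab_group_add, 'm) dg_va_scheme \<Rightarrow> complex fps \<Rightarrow> int \<Rightarrow> 'a \<Rightarrow> 'a \<Rightarrow> 'a" where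
  "residue V f k u v = Sum_any (\<lambda>n::nat. scl V (fps_nth f n) (mode V u (int n - k) v))"

context dg_vertex_algebra
begin

lemma residue_eq_sum:
  assumes "\<And>n. n \<ge> N \<Longrightarrow> mode V u (int n - k) v = 0"
  shows "residue V f k u v = (\<Sum>n<N. scl V (fps_nth f n) (mode V u (int n - k) v))"
  unfolding residue_def by (rule Sum_any_atLeast0) (simp add: assms)

lemma residue_bound:
  "\<exists>N. \<forall>M\<ge>N. \<forall>f. residue V f k u v = (\<Sum>n<M. scl V (fps_nth f n) (mode V u (int n - k) v))"
  using finite_nonzero_modes[of u k v] residue_eq_sum by (meson order_trans)

lemma residue_linear_left: "lin (\<lambda>u. residue V f k u v)"
proof (rule linearI)
  fix x y c
  obtain N1 where 1: "\<forall>M\<ge>N1. \<forall>f. residue V f k x v = (\<Sum>n<M. scl V (fps_nth f n) (mode V x (int n - k) v))" using residue_bound by blast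
  obtain N2 where 2: "\<forall>M\<ge>N2. \<forall>f. residue V f k y v = (\<Sum>n<M. scl V (fps_nth f n) (mode V y (int n - k) v))" using residue_bound by blast
  obtain N3 where 3: "\<forall>M\<ge>N3. \<forall>f. residue V f k (x + y) v = (\<Sum>n<M. scl V (fps_nth f n) (mode V (x + y) (int n - k) v))" using residue_bound by blast
  obtain N4 where 4: "\<forall>M\<ge>N4. \<forall>f. residue V f k (scl V c x) v = (\<Sum>n<M. scl V (fps_nth f n) (mode V (scl V c x) (int n - k) v))" using residue_bound by blast
  define M where "M = max (max N1 N2) (max N3 N4)"
  show "residue V f k (x + y) v = residue V f k x v + residue V f k y v"
    by (simp add: 1[rule_format, of M] 2[rule_format, of M] 3[rule_format, of M] M_def mode_left.add scale_right_distrib sum.distrib)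
  show "residue V f k (scl V c x) v = scl V c (residue V f k x v)"
    by (simp add: 1[rule_format, of M] 4[rule_format, of M] M_def mode_left.scale scale_sum_right mult_ac)
qed

lemma residue_linear_right: "lin (residue V f k u)"
proof (rule linearI)
  fix x y c
  obtain N1 where 1: "\<forall>M\<ge>N1. \<forall>f. residue V f k u x = (\<Sum>n<M. scl V (fps_nth f n) (mode V u (int n - k) x))" using residue_bound by blast
  obtain N2 where 2: "\<forall>M\<ge>N2. \<forall>f. residue V f k u y = (\<Sum>n<M. scl V (fps_nth f n) (mode V u (int n - k) y))" using residue_bound by blast
  obtain N3 where 3: "\<forall>M\<ge>N3. \<forall>f. residue V f k u (x + y) = (\<Sum>n<M. scl V (fps_nth f n) (mode V u (int n - k) (x + y)))" using residue_bound by blast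
  obtain N4 where 4: "\<forall>M\<ge>N4. \<forall>f. residue V f k u (scl V c x) = (\<Sum>n<M. scl V (fps_nth f n) (mode V u (int n - k) (scl V c x)))" using residue_bound by blast
  define M where "M = max (max N1 N2) (max N3 N4)"
  show "residue V f k u (x + y) = residue V f k u x + residue V f k u y"
    by (simp add: 1[rule_format, of M] 2[rule_format, of M] 3[rule_format, of M] M_def mode_right.add scale_right_distrib sum.distrib)
  show "residue V f k u (scl V c x) = scl V c (residue V f k u x)"
    by (simp add: 1[rule_format, of M] 4[rule_format, of M] M_def mode_right.scale scale_sum_right mult_ac)
qed

sublocale residue_left: Vector_Spaces.linear "scl V" "scl V" "\<lambda>u. residue V f k u v" for f k v
  by (rule residue_linear_left)

sublocale residue_right: Vector_Spaces.linear "scl V" "scl V" "residue V f k u" for f k u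
  by (rule residue_linear_right)

lemma residue_add: "residue V (f + g) k u v = residue V f k u v + residue V g k u v"
proof -
  obtain N where "\<And>f. residue V f k u v = (\<Sum>n<N. scl V (fps_nth f n) (mode V u (int n - k) v))" using residue_bound by blast
  then show ?thesis by (simp add: scale_left_distrib sum.distrib)
qed

lemma residue_const_mult: "residue V (fps_const c * f) k u v = scl V c (residue V f k u v)"
proof -
  obtain N where "\<And>f. residue V f k u v = (\<Sum>n<N. scl V (fps_nth f n) (mode V u (int n - k) v))" using residue_bound by blast
  then show ?thesis by (simp add: scale_sum_right)
qed

lemma residue_sum: "residue V (\<Sum>i\<in>S. F i) k u v = (\<Sum>i\<in>S. residue V (F i) k u v)"
proof -
  have "residue V 0 k u v = 0" by (simp add: residue_def)
  then show ?thesis by (induction S rule: infinite_finite_induct) (auto simp: residue_add)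
qed

lemma residue_X: "residue V (fps_X * f) (k + 1) u v = residue V f k u v"
proof -
  obtain N1 where 1: "\<forall>M\<ge>N1. \<forall>f. residue V f k u v = (\<Sum>n<M. scl V (fps_nth f n) (mode V u (int n - k) v))" using residue_bound by blast
  obtain N2 where 2: "\<forall>M\<ge>N2. \<forall>f. residue V f (k + 1) u v = (\<Sum>n<M. scl V (fps_nth f n) (mode V u (int n - (k + 1)) v))" using residue_bound by blast
  have "residue V (fps_X * f) (k + 1) u v
      = (\<Sum>n<Suc (max N1 N2). scl V (fps_nth (fps_X * f) n) (mode V u (int n - (k + 1)) v))"
    by (rule 2[rule_format]) simp
  also have "\<dots> = (\<Sum>n<max N1 N2. scl V (fps_nth f n) (mode V u (int n - k) v))"
    by (subst sum.lessThan_Suc_shift) (simp add: algebra_simps)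
  also have "\<dots> = residue V f k u v" by (rule 1[rule_format, symmetric]) simp
  finally show ?thesis .
qed

lemma residue_X_power: "residue V (fps_X ^ j * f) (k + int j) u v = residue V f k u v"
proof (induction j)
  case (Suc j)
  have "residue V (fps_X ^ Suc j * f) (k + int (Suc j)) u v = residue V (fps_X * (fps_X ^ j * f)) ((k + int j) + 1) u v"
    by (simp add: mult.assoc add_ac)
  also have "\<dots> = residue V (fps_X ^ j * f) (k + int j) u v" by (rule residue_X)
  finally show ?case using Suc by simp
qed simp

text \<open>
  Integration by parts: $Y(L(-1)u,x)$ is the derivative of $Y(u,x)$, and
  $-(f x^{-k})' = (kf - xf') x^{-k-1}$.
\<close>

lemma residue_translate:
  "residue V f k (mode V u (-2) (vac V)) v
    = residue V (fps_const (of_int k) * f - fps_X * fps_deriv f) (k + 1) u v"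
proof -
  have "fps_nth (fps_const (of_int k) * f - fps_X * fps_deriv f) n = (of_int k - of_nat n) * fps_nth f n" for n
    by (cases n) (auto simp: algebra_simps)
  moreover have "fps_nth f n * - of_int (int n - k) = (of_int k - of_nat n) * fps_nth f n" for n
    by (simp add: algebra_simps)
  moreover have "int n - k - 1 = int n - (k + 1)" for n by simp
  ultimately show ?thesis
    unfolding residue_def by (simp only: mode_translate scale_scale)
qed

text \<open>
  Multiply the commutator formula for $u_{r-j}$ and $v_{s-k}$ by $f_r g_s$ and sum over $r$ and $s$.
  The series multiplying $g$ on the right is $x^{i+j} \frac1{i!} \frac{d^i}{dx^i} (f x^{-j})$.
\<close>

lemma residue_commutator:
  assumes "u \<in> deg_part V p" "v \<in> deg_part V q"
  shows "residue V f j u (residue V g k v w) - scl V (sgn_pow (p * q)) (residue V g k v (residue V f j u w))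
    = Sum_any (\<lambda>i. residue V (Abs_fps (\<lambda>r. (of_int (int r - j) gchoose i) * fps_nth f r) * g)
        (j + k + int i) (mode V u (int i) v) w)"
proof -
  define A where "A r s = mode V u (int r - j) (mode V v (int s - k) w)" for r s
  define B where "B r s = mode V v (int s - k) (mode V u (int r - j) w)" for r s
  obtain N1 where N1: "\<forall>n\<ge>N1. mode V v (int n - k) w = 0" using finite_nonzero_modes by blast
  obtain N2 where N2: "\<forall>n\<ge>N2. mode V u (int n - j) w = 0" using finite_nonzero_modes by blast
  have "\<forall>s. \<exists>N. \<forall>r\<ge>N. A r s = 0" unfolding A_def using finite_nonzero_modes by blast
  then obtain NA where NA: "\<And>s r. r \<ge> NA s \<Longrightarrow> A r s = 0" by metis
  have "\<forall>r. \<exists>N. \<forall>s\<ge>N. B r s = 0" unfolding B_def using finite_nonzero_modes by blast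
  then obtain NB where NB: "\<And>s r. s \<ge> NB r \<Longrightarrow> B r s = 0" by metis
  \<comment> \<open>The bound for \<open>r\<close> in \<open>A r s\<close> depends on \<open>s\<close>, but only finitely many \<open>s\<close> matter.\<close>
  define N where "N = N1 + N2 + sum NA {..<N1} + sum NB {..<N2}"
  have A0: "A r s = 0" if "r \<ge> N \<or> s \<ge> N" for r s
  proof (cases "s < N1")
    case True
    then have "NA s \<le> sum NA {..<N1}" by (intro member_le_sum) auto
    with True that have "NA s \<le> r" by (auto simp: N_def)
    then show ?thesis by (rule NA)
  next
    case False
    then show ?thesis using N1 by (simp add: A_def)
  qed
  have B0: "B r s = 0" if "r \<ge> N \<or> s \<ge> N" for r s
  proof (cases "r < N2")
    case True
    then have "NB r \<le> sum NB {..<N2}" by (intro member_le_sum) auto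
    with True that have "NB r \<le> s" by (auto simp: N_def)
    then show ?thesis by (rule NB)
  next
    case False
    then show ?thesis using N2 by (simp add: B_def)
  qed
  have vw: "residue V g k v w = (\<Sum>s<N. scl V (fps_nth g s) (mode V v (int s - k) w))"
    by (rule residue_eq_sum) (use N1 in \<open>auto simp: N_def\<close>)
  have uw: "residue V f j u w = (\<Sum>r<N. scl V (fps_nth f r) (mode V u (int r - j) w))"
    by (rule residue_eq_sum) (use N2 in \<open>auto simp: N_def\<close>)
  have modeA: "mode V u (int r - j) (residue V g k v w) = (\<Sum>s<N. scl V (fps_nth g s) (A r s))" for r
    by (simp add: vw mode_right.sum mode_right.scale A_def)
  have modeB: "mode V v (int s - k) (residue V f j u w) = (\<Sum>r<N. scl V (fps_nth f r) (B r s))" for s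
    by (simp add: uw mode_right.sum mode_right.scale B_def)
  have LA: "residue V f j u (residue V g k v w) = (\<Sum>r<N. \<Sum>s<N. scl V (fps_nth f r * fps_nth g s) (A r s))"
    by (subst residue_eq_sum[of N]) (simp_all add: modeA A0 scale_sum_right)
  have LB: "residue V g k v (residue V f j u w) = (\<Sum>r<N. \<Sum>s<N. scl V (fps_nth f r * fps_nth g s) (B r s))"
    by (subst residue_eq_sum[of N], simp add: modeB B0, subst sum.swap)
      (simp add: modeB scale_sum_right mult.commute)

  obtain I where I: "\<forall>i\<ge>I. mode V u (int i) v = 0"
    using finite_nonzero_modes[of u 0 v] by auto
  have "\<forall>i. \<exists>M. \<forall>t\<ge>M. mode V (mode V u (int i) v) (int t - (j + k + int i)) w = 0"
    using finite_nonzero_modes by blast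
  then obtain MM where MM: "\<And>i t. t \<ge> MM i \<Longrightarrow> mode V (mode V u (int i) v) (int t - (j + k + int i)) w = 0"
    by metis
  \<comment> \<open>The iterates on the right vanish only for large \<open>r + s\<close>, so the sum over the square
    \<open>r, s < N\<close> is extended to the triangle \<open>r + s < M\<close> before the terms are separated.\<close>
  define M where "M = 2 * N + sum MM {..<I}"
  have M0: "mode V (mode V u (int i) v) (int t - (j + k + int i)) w = 0" if "t \<ge> M" "i < I" for i t
  proof -
    have "MM i \<le> sum MM {..<I}" using that by (intro member_le_sum) auto
    with that show ?thesis by (intro MM) (simp add: M_def)
  qed
  define G where "G r s = scl V (fps_nth f r * fps_nth g s) (A r s - scl V (sgn_pow (p * q)) (B r s))" for r s
  have G0: "G r s = 0" if "r \<ge> N \<or> s \<ge> N" for r s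
    using A0[OF that] B0[OF that] by (simp add: G_def)
  have G: "G r s = (\<Sum>i<I. scl V ((of_int (int r - j) gchoose i) * fps_nth f r * fps_nth g s)
      (mode V (mode V u (int i) v) (int (r + s) - (j + k + int i)) w))" for r s
  proof -
    have "A r s - scl V (sgn_pow (p * q)) (B r s)
      = Sum_any (\<lambda>i. scl V (of_int (int r - j) gchoose i)
          (mode V (mode V u (int i) v) ((int r - j) + (int s - k) - int i) w))"
      unfolding A_def B_def by (rule commutator[OF assms])
    also have "\<dots> = (\<Sum>i<I. scl V (of_int (int r - j) gchoose i)
          (mode V (mode V u (int i) v) ((int r - j) + (int s - k) - int i) w))"
      by (rule Sum_any_atLeast0) (simp add: I)
    finally show ?thesis unfolding G_def by (simp add: scale_sum_right mult_ac algebra_simps)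
  qed
  have "residue V f j u (residue V g k v w) - scl V (sgn_pow (p * q)) (residue V g k v (residue V f j u w))
      = (\<Sum>r<N. \<Sum>s<N. G r s)"
    unfolding LA LB G_def by (simp add: scale_sum_right sum_subtractf scale_right_diff_distrib mult_ac)
  also have "\<dots> = (\<Sum>(r, s)\<in>{..<N} \<times> {..<N}. G r s)" by (rule sum.cartesian_product)
  also have "\<dots> = (\<Sum>(r, s)\<in>{(r, s). r + s < M}. G r s)"
  proof (rule sum.mono_neutral_left)
    have "{(r, s). r + s < M} \<subseteq> {..<M} \<times> {..<M}" by auto
    then show "finite {(r, s). r + s < M}" by (rule finite_subset) simp
    show "{..<N} \<times> {..<N} \<subseteq> {(r, s). r + s < M}" by (auto simp: M_def)
    show "\<forall>x\<in>{(r, s). r + s < M} - {..<N} \<times> {..<N}. (case x of (r, s) \<Rightarrow> G r s) = 0"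
      by (clarsimp simp: G0) (metis G0 linorder_not_less)
  qed
  also have "\<dots> = (\<Sum>t<M. \<Sum>r\<le>t. G r (t - r))" by (rule sum.triangle_reindex)
  also have "\<dots> = (\<Sum>t<M. \<Sum>r\<le>t. \<Sum>i<I. scl V ((of_int (int r - j) gchoose i) * fps_nth f r * fps_nth g (t - r))
      (mode V (mode V u (int i) v) (int t - (j + k + int i)) w))"
    by (intro sum.cong) (simp_all add: G)
  also have "\<dots> = (\<Sum>i<I. \<Sum>t<M. \<Sum>r\<le>t. scl V ((of_int (int r - j) gchoose i) * fps_nth f r * fps_nth g (t - r))
      (mode V (mode V u (int i) v) (int t - (j + k + int i)) w))"
    by (rule trans[OF sum.cong[OF refl sum.swap] sum.swap])
  also have "\<dots> = (\<Sum>i<I. residue V (Abs_fps (\<lambda>r. (of_int (int r - j) gchoose i) * fps_nth f r) * g)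
        (j + k + int i) (mode V u (int i) v) w)"
  proof (rule sum.cong)
    fix i assume "i \<in> {..<I}"
    then show "(\<Sum>t<M. \<Sum>r\<le>t. scl V ((of_int (int r - j) gchoose i) * fps_nth f r * fps_nth g (t - r))
      (mode V (mode V u (int i) v) (int t - (j + k + int i)) w))
      = residue V (Abs_fps (\<lambda>r. (of_int (int r - j) gchoose i) * fps_nth f r) * g)
        (j + k + int i) (mode V u (int i) v) w"
      by (subst residue_eq_sum[of M]) (simp_all add: M0 fps_mult_nth scale_sum_left atLeast0AtMost)
  qed simp
  also have "\<dots> = Sum_any (\<lambda>i. residue V (Abs_fps (\<lambda>r. (of_int (int r - j) gchoose i) * fps_nth f r) * g)
        (j + k + int i) (mode V u (int i) v) w)"
    by (rule Sum_any_atLeast0[symmetric]) (simp add: I residue_left.zero)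
  finally show ?thesis .
qed

end

section \<open>The subspace $O(V)$\<close>

context dg_vertex_operator_algebra
begin

lemma component_weight_space:
  assumes "u \<in> weight_space V a"
  shows "component (weight_space V) w u = (if w = a then u else 0)"
  by (rule component_single[OF weight_direct_sum assms]) simp

lemma zhu_mult_weight:
  assumes "u \<in> weight_space V a"
  shows "zhu_mult V u v = residue V (fps_binomial (of_real a)) 1 u v"
  unfolding zhu_mult_def
  by (subst Sum_any_single[of a]) (auto simp: component_weight_space[OF assms] residue_def)

lemma zhu_circ_weight:
  assumes "u \<in> weight_space V a"
  shows "zhu_circ V u v = residue V (fps_binomial (of_real a)) 2 u v"
  unfolding zhu_circ_def
  by (subst Sum_any_single[of a]) (auto simp: component_weight_space[OF assms] residue_def)

lemma zhu_circ_add_left: "zhu_circ V (x + y) v = zhu_circ V x v + zhu_circ V y v"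
proof -
  interpret wt: Vector_Spaces.linear "scl V" "scl V" "component (weight_space V) w" for w
    by (rule component_linear[OF weight_direct_sum weight_subspace])
  have fin: "finite {w. residue V (fps_binomial (of_real w)) 2 (component (weight_space V) w u) v \<noteq> 0}" for u
  proof (rule finite_subset)
    show "{w. residue V (fps_binomial (of_real w)) 2 (component (weight_space V) w u) v \<noteq> 0}
      \<subseteq> {w. component (weight_space V) w u \<noteq> 0}" by (auto simp: residue_left.zero)
    show "finite {w. component (weight_space V) w u \<noteq> 0}"
      using decomposition_component[OF weight_direct_sum, of u] by (simp add: decomposition_def)
  qed
  have circ: "zhu_circ V u v = (\<Sum>w. residue V (fps_binomial (of_real w)) 2 (component (weight_space V) w u) v)" for u
    unfolding zhu_circ_def residue_def by simp
  show ?thesis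
    unfolding circ by (simp add: wt.add residue_left.add Sum_any.distrib[OF fin fin])
qed

lemma zhu_O_subspace: "subspace (zhu_O V)"
  by (simp add: zhu_O_def)

lemma residue_in_zhu_O:
  assumes "u \<in> weight_space V a"
  shows "residue V (fps_binomial (of_real a)) 2 u v \<in> zhu_O V"
  unfolding zhu_O_def by (rule span_base) (use zhu_circ_weight[OF assms, symmetric] in blast)

text \<open>
  In general $u$ is a sum of vectors of different weights and $u \circ v$ is the sum of residues against
  different powers of $1 + x$.  Bihomogeneous $u$ suffice as generators by additivity.
\<close>

lemma zhu_O_eq_span:
  "zhu_O V = span {residue V (fps_binomial (of_real a)) 2 u v |p a u v. u \<in> bipart V p a}" (is "_ = span ?B")
proof (rule equalityI)
  have "zhu_circ V u v \<in> span ?B" for u v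
  proof (induction u rule: bihom_induct)
    case (bihom p a u)
    then show ?case unfolding zhu_circ_weight[OF bipart_weight[OF bihom]] by (intro span_base) blast
  qed (simp add: zhu_circ_add_left span_add)
  then show "zhu_O V \<subseteq> span ?B"
    unfolding zhu_O_def by (intro span_minimal) auto
  show "span ?B \<subseteq> zhu_O V"
    by (rule span_minimal[OF _ zhu_O_subspace]) (auto intro: residue_in_zhu_O bipart_weight)
qed

lemma fps_binomial_Suc:
  "fps_binomial (c + 1) = fps_binomial c + fps_X * fps_binomial (c :: complex)"
  by (simp add: fps_binomial_add_mult fps_binomial_1 algebra_simps)

lemma fps_binomial_by_parts:
  fixes c k :: complex
  shows "fps_const k * fps_binomial (c + 1) - fps_X * fps_deriv (fps_binomial (c + 1))
    = fps_const k * fps_binomial c + fps_const (k - c - 1) * (fps_X * fps_binomial c)"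
proof -
  have deriv: "fps_deriv (fps_binomial (c + 1)) = fps_const (c + 1) * fps_binomial c"
  proof (rule fps_ext)
    fix n show "fps_nth (fps_deriv (fps_binomial (c + 1))) n = fps_nth (fps_const (c + 1) * fps_binomial c) n"
      using gbinomial_absorption[of n "c + 1"] by simp
  qed
  have const: "fps_const (k - c - 1) = fps_const k - fps_const (c + 1)"
    by (simp add: diff_diff_eq)
  show ?thesis
    unfolding deriv const unfolding fps_binomial_Suc by (simp only: algebra_simps)
qed

text \<open>
  Replacing $u$ by $L(-1)u$ integrates by parts and raises the order of the pole, with a multiple of
  the old residue as the only other term.
\<close>

lemma residue_pole_in_zhu_O:
  assumes "u \<in> weight_space V a"
  shows "residue V (fps_binomial (of_real a)) (2 + int m) u v \<in> zhu_O V"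
  using assms
proof (induction m arbitrary: u a)
  case 0
  then show ?case using residue_in_zhu_O by simp
next
  case (Suc m)
  let ?c = "of_real a :: complex" and ?k = "2 + int m"
  let ?Tu = "mode V u (-2) (vac V)" and ?r = "\<lambda>f k. residue V f k u v"
  have "?Tu \<in> weight_space V (a + 1)"
    using mode_weight[OF Suc.prems vac_weight, of "-2"] by (simp add: add.commute)
  from Suc.IH[OF this]
  have "residue V (fps_binomial (?c + 1)) ?k ?Tu v \<in> zhu_O V" by simp
  moreover have "fps_const (of_int ?k) * fps_binomial (?c + 1) - fps_X * fps_deriv (fps_binomial (?c + 1))
      = fps_const (of_int ?k) * fps_binomial ?c + fps_const (of_int ?k - ?c - 1) * (fps_X * fps_binomial ?c)"
    by (rule fps_binomial_by_parts)
  ultimately have "scl V (of_int ?k) (?r (fps_binomial ?c) (?k + 1))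
      + scl V (of_int ?k - ?c - 1) (?r (fps_binomial ?c) ?k) \<in> zhu_O V"
    unfolding residue_translate by (simp only: residue_add residue_const_mult residue_X)
  moreover have "scl V (of_int ?k - ?c - 1) (?r (fps_binomial ?c) ?k) \<in> zhu_O V"
    by (rule subspace_scale[OF zhu_O_subspace Suc.IH[OF Suc.prems]])
  ultimately have "scl V (of_int ?k) (?r (fps_binomial ?c) (?k + 1)) \<in> zhu_O V"
    using subspace_diff[OF zhu_O_subspace] by fastforce
  then have "scl V (inverse (of_int ?k)) (scl V (of_int ?k) (?r (fps_binomial ?c) (?k + 1))) \<in> zhu_O V"
    by (rule subspace_scale[OF zhu_O_subspace])
  moreover have "(of_int ?k :: complex) \<noteq> 0"
  proof -
    have "?k \<noteq> 0" by simp
    then show ?thesis by (simp only: of_int_eq_0_iff not_False_eq_True)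
  qed
  ultimately have "?r (fps_binomial ?c) (?k + 1) \<in> zhu_O V" by simp
  then show ?case by (simp add: algebra_simps)
qed

text \<open>
  Each factor $1 + x$ splits the residue into one with the same pole and one whose pole is lower by
  one, so $n$ factors are harmless as long as the pole has order at least $2 + n$.
\<close>

lemma residue_binomial_in_zhu_O:
  assumes "u \<in> weight_space V a" "n \<le> m"
  shows "residue V (fps_binomial (of_real a + of_nat n)) (2 + int m) u v \<in> zhu_O V"
  using assms(2)
proof (induction n arbitrary: m)
  case 0
  then show ?case using residue_pole_in_zhu_O[OF assms(1)] by simp
next
  case (Suc n)
  then obtain m' where m: "m = Suc m'" and n: "n \<le> m'" by (cases m) auto
  let ?f = "fps_binomial (of_real a + of_nat n :: complex)"
  have "fps_binomial (of_real a + of_nat (Suc n) :: complex) = ?f + fps_X * ?f"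
    using fps_binomial_Suc[of "of_real a + of_nat n"] by (simp add: add_ac)
  moreover have "residue V (fps_X * ?f) ((2 + int m') + 1) u v = residue V ?f (2 + int m') u v"
    by (rule residue_X)
  ultimately have "residue V (fps_binomial (of_real a + of_nat (Suc n))) (2 + int m) u v
      = residue V ?f (2 + int m) u v + residue V ?f (2 + int m') u v"
    by (simp add: residue_add m add_ac)
  then show ?case using Suc.IH[of m] Suc.IH[of m'] Suc.prems n
    by (simp add: subspace_add[OF zhu_O_subspace])
qed

text \<open>
  The series on the left is $x^{i+1} \frac{1}{i!} \frac{d^i}{dx^i} \frac{(1+x)^c}{x}$, and the right
  side is the Leibniz rule for this product.  In terms of coefficients it is an alternating sum of
  binomial coefficients.
\<close>

lemma binomial_over_X_expansion:
  "Abs_fps (\<lambda>r. (of_int (int r - 1) gchoose i) * fps_nth (fps_binomial (c :: complex)) r)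
    = (\<Sum>l\<le>i. fps_const ((-1) ^ (i - l) * (c gchoose l)) * (fps_X ^ l * fps_binomial (c - of_nat l)))"
proof (rule fps_ext)
  fix r
  have sgn: "(-1) ^ (i - l) = (-1) ^ i * ((-1) ^ l :: complex)" if "l \<le> i" for l
  proof -
    have "(-1) ^ i = (-1) ^ (i - l) * ((-1) ^ l :: complex)" using that by (simp flip: power_add)
    moreover have "(-1) ^ l * (-1) ^ l = (1 :: complex)" by (simp flip: power_add)
    ultimately show ?thesis by (simp add: mult.assoc)
  qed
  have trinomial: "(c gchoose l) * fps_nth (fps_X ^ l * fps_binomial (c - of_nat l)) r
      = (c gchoose r) * (of_nat r gchoose l)" for l
  proof (cases "l \<le> r")
    case True
    then show ?thesis using gbinomial_trinomial_revision[of l r c] by (simp add: fps_X_power_mult_nth)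
  next
    case False
    then have "((of_nat r :: complex) gchoose l) = 0"
      by (simp flip: binomial_gbinomial add: binomial_eq_0)
    with False show ?thesis by (simp add: fps_X_power_mult_nth)
  qed
  have "fps_nth (\<Sum>l\<le>i. fps_const ((-1) ^ (i - l) * (c gchoose l)) * (fps_X ^ l * fps_binomial (c - of_nat l))) r
      = (\<Sum>l\<le>i. (-1) ^ (i - l) * ((c gchoose l) * fps_nth (fps_X ^ l * fps_binomial (c - of_nat l)) r))"
    by (simp add: fps_sum_nth mult.assoc)
  also have "\<dots> = (\<Sum>l\<le>i. (-1) ^ i * (-1) ^ l * ((c gchoose r) * (of_nat r gchoose l)))"
    by (intro sum.cong) (simp_all only: trinomial sgn atMost_iff)
  also have "\<dots> = (c gchoose r) * ((-1) ^ i * (\<Sum>l\<le>i. (of_nat r gchoose l) * (-1) ^ l))"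
    by (simp add: sum_distrib_left mult_ac)
  also have "(\<Sum>l\<le>i. ((of_nat r :: complex) gchoose l) * (-1) ^ l) = (-1) ^ i * ((of_nat r - 1) gchoose i)"
    by (rule gbinomial_sum_lower_neg)
  also have "(c gchoose r) * ((-1) ^ i * ((-1) ^ i * ((of_nat r - 1) gchoose i)))
      = (c gchoose r) * ((of_nat r - 1) gchoose i)"
    by (simp flip: mult.assoc power_add)
  finally show "fps_nth (Abs_fps (\<lambda>r. (of_int (int r - 1) gchoose i) * fps_nth (fps_binomial c) r)) r
    = fps_nth (\<Sum>l\<le>i. fps_const ((-1) ^ (i - l) * (c gchoose l)) * (fps_X ^ l * fps_binomial (c - of_nat l))) r"
    by simp
qed

text \<open>
  The analogue for $x^i \frac{1}{i!} \frac{d^i}{dx^i} (1+x)^c$.  The subtracted $0$ is the value of $j$ in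
  \<open>residue_commutator\<close>.
\<close>

lemma binomial_expansion:
  "Abs_fps (\<lambda>r. (of_int (int r - 0) gchoose i) * fps_nth (fps_binomial (c :: complex)) r)
    = fps_const (c gchoose i) * (fps_X ^ i * fps_binomial (c - of_nat i))"
proof (rule fps_ext)
  fix r
  show "fps_nth (Abs_fps (\<lambda>r. (of_int (int r - 0) gchoose i) * fps_nth (fps_binomial (c :: complex)) r)) r
    = fps_nth (fps_const (c gchoose i) * (fps_X ^ i * fps_binomial (c - of_nat i))) r"
  proof (cases "i \<le> r")
    case True
    then show ?thesis using gbinomial_trinomial_revision[of i r c] by (simp add: fps_X_power_mult_nth mult.commute)
  next
    case False
    then have "((of_nat r :: complex) gchoose i) = 0"
      by (simp flip: binomial_gbinomial add: binomial_eq_0)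
    with False show ?thesis by (simp add: fps_X_power_mult_nth)
  qed
qed

lemma subspace_Sum_any:
  assumes "subspace S" "\<And>i. f i \<in> S"
  shows "Sum_any f \<in> S"
  using assms by (cases "finite {i. f i \<noteq> 0}") (auto simp: Sum_any.expand_set subspace_sum subspace_0)

text \<open>
  For $x = v \circ w$ the commutator of $u \ast {}$ and $v \circ {}$ produces only iterates $u_i v$.  Their
  residues are taken against $(1+x)^{\operatorname{wt}(u_i v) + n} x^{-2-n}$ with $n \ge 1$ and therefore
  lie in $O(V)$.
\<close>

lemma zhu_mult_zhu_O:
  assumes u: "u \<in> bipart V p b" and x: "x \<in> zhu_O V"
  shows "residue V (fps_binomial (of_real b)) 1 u x \<in> zhu_O V"
proof (rule span_linear_into[OF residue_linear_right zhu_O_subspace _ x[unfolded zhu_O_eq_span]])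
  fix x assume "x \<in> {residue V (fps_binomial (of_real a)) 2 u v |p a u v. u \<in> bipart V p a}"
  then obtain q a v w where v: "v \<in> bipart V q a" and x: "x = residue V (fps_binomial (of_real a)) 2 v w"
    by blast
  let ?b = "of_real b :: complex" and ?a = "of_real a :: complex"
  have "residue V (Abs_fps (\<lambda>r. (of_int (int r - 1) gchoose i) * fps_nth (fps_binomial ?b) r) * fps_binomial ?a)
      (1 + 2 + int i) (mode V u (int i) v) w \<in> zhu_O V" (is "residue V (?h * _) ?k ?c w \<in> _") for i
  proof -
    have c: "?c \<in> weight_space V (b + a - of_int (int i) - 1)"
      by (rule mode_weight) (use u v in \<open>auto dest: bipart_weight\<close>)
    have "residue V (fps_X ^ l * fps_binomial (?b - of_nat l + ?a)) ?k ?c w \<in> zhu_O V" if "l \<le> i" for l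
    proof -
      have wt: "of_real (b + a - of_int (int i) - 1) + of_nat (i - l + 1) = ?b - of_nat l + ?a"
        using that by (simp add: of_nat_diff)
      have k: "?k = (2 + int (i - l + 1)) + int l" using that by simp
      show ?thesis
        unfolding k residue_X_power
        using residue_binomial_in_zhu_O[OF c order_refl, of "i - l + 1" w] by (simp only: wt)
    qed
    moreover have "?h * fps_binomial ?a
      = (\<Sum>l\<le>i. fps_const ((-1) ^ (i - l) * (?b gchoose l)) * (fps_X ^ l * fps_binomial (?b - of_nat l + ?a)))"
      unfolding binomial_over_X_expansion by (simp add: sum_distrib_right fps_binomial_add_mult mult.assoc)
    ultimately show ?thesis
      by (simp only: residue_sum residue_const_mult)
        (auto intro!: subspace_sum subspace_scale zhu_O_subspace)
  qed
  then have "residue V (fps_binomial ?b) 1 u x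
      - scl V (sgn_pow (p * q)) (residue V (fps_binomial ?a) 2 v (residue V (fps_binomial ?b) 1 u w)) \<in> zhu_O V"
    unfolding x residue_commutator[OF bipart_degree[OF u] bipart_degree[OF v]]
    by (intro subspace_Sum_any zhu_O_subspace)
  moreover have "scl V (sgn_pow (p * q)) (residue V (fps_binomial ?a) 2 v (residue V (fps_binomial ?b) 1 u w)) \<in> zhu_O V"
    by (intro subspace_scale zhu_O_subspace residue_in_zhu_O bipart_weight[OF v])
  ultimately show "residue V (fps_binomial ?b) 1 u x \<in> zhu_O V"
    using subspace_add[OF zhu_O_subspace] by fastforce
qed

text \<open>
  The operator $\operatorname{Res}_x (1+x)^{\operatorname{wt}(u) - 1} Y(u,x)$ is a derivation of
  $\circ$ up to sign: it maps $v \circ w$ to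
  $\sum_i \binom{\operatorname{wt}(u) - 1}{i} (u_i v) \circ w$ plus a multiple of $v \circ w'$.
\<close>

lemma zhu_derivation_zhu_O:
  assumes u: "u \<in> bipart V p b" and x: "x \<in> zhu_O V"
  shows "residue V (fps_binomial (of_real b - 1)) 0 u x \<in> zhu_O V"
proof (rule span_linear_into[OF residue_linear_right zhu_O_subspace _ x[unfolded zhu_O_eq_span]])
  fix x assume "x \<in> {residue V (fps_binomial (of_real a)) 2 u v |p a u v. u \<in> bipart V p a}"
  then obtain q a v w where v: "v \<in> bipart V q a" and x: "x = residue V (fps_binomial (of_real a)) 2 v w"
    by blast
  let ?b = "of_real b - 1 :: complex" and ?a = "of_real a :: complex"
  have "residue V (Abs_fps (\<lambda>r. (of_int (int r - 0) gchoose i) * fps_nth (fps_binomial ?b) r) * fps_binomial ?a)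
      (0 + 2 + int i) (mode V u (int i) v) w \<in> zhu_O V" (is "residue V (?h * _) ?k ?c w \<in> _") for i
  proof -
    have c: "?c \<in> weight_space V (b + a - of_int (int i) - 1)"
      by (rule mode_weight) (use u v in \<open>auto dest: bipart_weight\<close>)
    have "?h * fps_binomial ?a
      = fps_const (?b gchoose i) * (fps_X ^ i * fps_binomial (of_real (b + a - of_int (int i) - 1)))"
      unfolding binomial_expansion
      by (simp add: mult.assoc algebra_simps flip: fps_binomial_add_mult)
    then have "residue V (?h * fps_binomial ?a) ?k ?c w
      = scl V (?b gchoose i) (residue V (fps_X ^ i * fps_binomial (of_real (b + a - of_int (int i) - 1))) (2 + int i) ?c w)"
      by (simp only: residue_const_mult add_0)
    then show ?thesis
      using residue_in_zhu_O[OF c] by (simp only: residue_X_power subspace_scale[OF zhu_O_subspace])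
  qed
  then have "residue V (fps_binomial ?b) 0 u x
      - scl V (sgn_pow (p * q)) (residue V (fps_binomial ?a) 2 v (residue V (fps_binomial ?b) 0 u w)) \<in> zhu_O V"
    unfolding x residue_commutator[OF bipart_degree[OF u] bipart_degree[OF v]]
    by (intro subspace_Sum_any zhu_O_subspace)
  moreover have "scl V (sgn_pow (p * q)) (residue V (fps_binomial ?a) 2 v (residue V (fps_binomial ?b) 0 u w)) \<in> zhu_O V"
    by (intro subspace_scale zhu_O_subspace residue_in_zhu_O bipart_weight[OF v])
  ultimately show "residue V (fps_binomial ?b) 0 u x \<in> zhu_O V"
    using subspace_add[OF zhu_O_subspace] by fastforce
qed

text \<open>
  Here $w_{-1-i} 1 = \frac1{i!} L(-1)^i w$, and $L(-1)w + L(0)w = w \circ 1$ makes $L(-1)$ act as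
  $-L(0)$ modulo $O(V)$.
\<close>

lemma divided_translate_zhu_O:
  assumes "w \<in> weight_space V a"
  shows "mode V w (-1 - int i) (vac V) - scl V (- of_real a gchoose i) w \<in> zhu_O V"
  using assms
proof (induction i arbitrary: w a)
  case 0
  then show ?case by (simp add: creation subspace_0[OF zhu_O_subspace])
next
  case (Suc i)
  let ?a = "of_real a :: complex" and ?Tw = "mode V w (-2) (vac V)"
  have Tw: "?Tw + scl V ?a w \<in> zhu_O V"
  proof -
    have "residue V (fps_binomial ?a) 2 w (vac V)
        = (\<Sum>n<2. scl V (fps_nth (fps_binomial ?a) n) (mode V w (int n - 2) (vac V)))"
      by (rule residue_eq_sum) (simp add: creation_regular)
    also have "\<dots> = ?Tw + scl V ?a w" by (simp add: numeral_2_eq_2 creation)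
    finally show ?thesis using residue_in_zhu_O[OF Suc.prems, of "vac V"] by simp
  qed
  have "?Tw \<in> weight_space V (a + 1)"
    using mode_weight[OF Suc.prems vac_weight, of "-2"] by (simp add: add.commute)
  from Suc.IH[OF this]
  have "mode V ?Tw (-1 - int i) (vac V) - scl V (- ?a - 1 gchoose i) ?Tw \<in> zhu_O V" by simp
  moreover have "mode V ?Tw (-1 - int i) (vac V) = scl V (of_nat (Suc i)) (mode V w (-1 - int (Suc i)) (vac V))"
    by (simp add: mode_translate add_ac diff_diff_eq)
  ultimately have "scl V (of_nat (Suc i)) (mode V w (-1 - int (Suc i)) (vac V))
      - scl V (- ?a - 1 gchoose i) ?Tw + scl V (- ?a - 1 gchoose i) (?Tw + scl V ?a w) \<in> zhu_O V"
    using Tw by (metis subspace_add subspace_scale zhu_O_subspace)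
  then have "scl V (of_nat (Suc i)) (mode V w (-1 - int (Suc i)) (vac V))
      - scl V (- ?a * (- ?a - 1 gchoose i)) w \<in> zhu_O V"
    by (simp add: scale_right_distrib mult.commute)
  then have "scl V (inverse (of_nat (Suc i))) (scl V (of_nat (Suc i)) (mode V w (-1 - int (Suc i)) (vac V))
      - scl V (of_nat (Suc i) * (- ?a gchoose Suc i)) w) \<in> zhu_O V"
    unfolding gbinomial_absorption by (rule subspace_scale[OF zhu_O_subspace])
  moreover have "(of_nat (Suc i) :: complex) \<noteq> 0" by (rule of_nat_neq_0)
  ultimately show ?case
    by (simp add: scale_right_diff_distrib mult.assoc[symmetric] del: of_nat_Suc mult.assoc)
qed

text \<open>
  By skew symmetry and the previous lemma the coefficient of $u_{m-1}v$ is a Vandermonde sum.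
\<close>

lemma zhu_mult_swap:
  assumes u: "u \<in> bipart V p b" and v: "v \<in> bipart V q a"
  shows "residue V (fps_binomial (of_real a)) 1 v u
    - scl V (sgn_pow (p * q)) (residue V (fps_binomial (of_real b - 1)) 1 u v) \<in> zhu_O V"
proof -
  let ?a = "of_real a :: complex" and ?b = "of_real b :: complex" and ?s = "sgn_pow (p * q)"
  let ?m = "\<lambda>n i. mode V u (int (n + i) - 1) v"
  obtain M where M: "\<forall>n\<ge>M. mode V u (int n - 1) v = 0" using finite_nonzero_modes by blast
  obtain M' where M': "\<forall>n\<ge>M'. mode V v (int n - 1) u = 0" using finite_nonzero_modes by blast
  define N where "N = max M M'"
  have m0: "?m n i = 0" if "n + i \<ge> N" for n i
    using M that unfolding N_def by (meson max.boundedE)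
  have skew: "mode V v (int n - 1) u
      = (\<Sum>i<N. scl V (?s * ((-1) ^ n * (-1) ^ i)) (mode V (?m n i) (-1 - int i) (vac V)))" for n
  proof -
    have "mode V v (int n - 1) u = scl V (?s * (-1) ^ n)
        (Sum_any (\<lambda>i. scl V ((-1) ^ i) (mode V (?m n i) (-1 - int i) (vac V))))"
      using skew_symmetry[OF bipart_degree[OF u] bipart_degree[OF v], of "int n - 1"]
      by (simp add: sgn_pow_of_nat algebra_simps)
    also have "Sum_any (\<lambda>i. scl V ((-1) ^ i) (mode V (?m n i) (-1 - int i) (vac V)))
        = (\<Sum>i<N. scl V ((-1) ^ i) (mode V (?m n i) (-1 - int i) (vac V)))"
    proof (rule Sum_any_atLeast0)
      fix i assume "i \<ge> N"
      then have "?m n i = 0" by (intro m0) simp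
      then show "scl V ((-1) ^ i) (mode V (?m n i) (-1 - int i) (vac V)) = 0" by simp
    qed
    finally show ?thesis by (simp add: scale_sum_right mult.assoc)
  qed
  define c where "c n i = (?a gchoose n) * (?s * ((-1) ^ n * (-1) ^ i))" for n i :: nat
  define e where "e n i = (- of_real (b + a - of_nat (n + i)) :: complex) gchoose i" for n i :: nat
  have "residue V (fps_binomial ?a) 1 v u = (\<Sum>n<N. scl V (?a gchoose n) (mode V v (int n - 1) u))"
    by (subst residue_eq_sum[of N]) (use M' in \<open>auto simp: N_def\<close>)
  also have "\<dots> = (\<Sum>n<N. \<Sum>i<N. scl V (c n i) (mode V (?m n i) (-1 - int i) (vac V)))"
    by (simp add: skew scale_sum_right c_def)
  finally have "residue V (fps_binomial ?a) 1 v u - (\<Sum>n<N. \<Sum>i<N. scl V (c n i) (scl V (e n i) (?m n i)))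
      = (\<Sum>n<N. \<Sum>i<N. scl V (c n i) (mode V (?m n i) (-1 - int i) (vac V) - scl V (e n i) (?m n i)))"
    by (simp only: sum_subtractf scale_right_diff_distrib)
  also have "\<dots> \<in> zhu_O V"
  proof (intro subspace_sum subspace_scale zhu_O_subspace)
    fix n i
    have "?m n i \<in> weight_space V (b + a - of_nat (n + i))"
      using mode_weight[OF bipart_weight[OF u] bipart_weight[OF v], of "int (n + i) - 1"] by (simp add: algebra_simps)
    then show "mode V (?m n i) (-1 - int i) (vac V) - scl V (e n i) (?m n i) \<in> zhu_O V"
      unfolding e_def by (rule divided_translate_zhu_O)
  qed
  also have "(\<Sum>n<N. \<Sum>i<N. scl V (c n i) (scl V (e n i) (?m n i)))
      = (\<Sum>(n, i)\<in>{..<N} \<times> {..<N}. scl V (c n i) (scl V (e n i) (?m n i)))"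
    by (rule sum.cartesian_product)
  also have "\<dots> = (\<Sum>(n, i)\<in>{(n, i). n + i < N}. scl V (c n i) (scl V (e n i) (?m n i)))"
  proof (rule sum.mono_neutral_right)
    show "{(n, i). n + i < N} \<subseteq> {..<N} \<times> {..<N}" by auto
    show "\<forall>x\<in>{..<N} \<times> {..<N} - {(n, i). n + i < N}. (case x of (n, i) \<Rightarrow> scl V (c n i) (scl V (e n i) (?m n i))) = 0"
      by (clarsimp simp del: of_nat_add) (metis m0 linorder_not_less scale_zero_right)
  qed simp
  also have "\<dots> = (\<Sum>t<N. \<Sum>n\<le>t. scl V (c n (t - n)) (scl V (e n (t - n)) (?m n (t - n))))"
    by (rule sum.triangle_reindex)
  also have "\<dots> = (\<Sum>t<N. scl V (?s * (?b - 1 gchoose t)) (mode V u (int t - 1) v))"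
  proof (rule sum.cong)
    fix t
    have "(\<Sum>n\<le>t. scl V (c n (t - n)) (scl V (e n (t - n)) (?m n (t - n))))
        = scl V (\<Sum>n\<le>t. c n (t - n) * e n (t - n)) (mode V u (int t - 1) v)"
      unfolding scale_sum_left by (rule sum.cong) auto
    also have "(\<Sum>n\<le>t. c n (t - n) * e n (t - n))
        = (\<Sum>n\<le>t. ?s * (-1) ^ t * ((?a gchoose n) * (of_nat t - ?b - ?a gchoose (t - n))))"
    proof (rule sum.cong)
      fix n assume "n \<in> {..t}"
      then have "(-1) ^ n * (-1) ^ (t - n) = ((-1) ^ t :: complex)" by (simp flip: power_add)
      then have "c n (t - n) = ?s * (-1) ^ t * (?a gchoose n)"
        by (simp add: c_def)
      moreover have "e n (t - n) = (of_nat t - ?b - ?a gchoose (t - n))"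
        using \<open>n \<in> {..t}\<close> by (simp add: e_def algebra_simps)
      ultimately show "c n (t - n) * e n (t - n)
          = ?s * (-1) ^ t * ((?a gchoose n) * (of_nat t - ?b - ?a gchoose (t - n)))" by simp
    qed simp
    also have "\<dots> = ?s * (-1) ^ t * (\<Sum>n\<in>{0..t}. (?a gchoose n) * (of_nat t - ?b - ?a gchoose (t - n)))"
      by (simp add: sum_distrib_left atLeast0AtMost)
    also have "(\<Sum>n\<in>{0..t}. (?a gchoose n) * (of_nat t - ?b - ?a gchoose (t - n))) = (of_nat t - ?b gchoose t)"
      by (subst gbinomial_Vandermonde) simp
    also have "?s * (-1) ^ t * (of_nat t - ?b gchoose t) = ?s * (?b - 1 gchoose t)"
      using gbinomial_negated_upper[of "?b - 1" t] by simp
    finally show "(\<Sum>n\<le>t. scl V (c n (t - n)) (scl V (e n (t - n)) (?m n (t - n))))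
        = scl V (?s * (?b - 1 gchoose t)) (mode V u (int t - 1) v)" .
  qed simp
  also have "\<dots> = scl V ?s (residue V (fps_binomial (?b - 1)) 1 u v)"
    by (subst residue_eq_sum[of N]) (use M in \<open>auto simp: N_def scale_sum_right\<close>)
  finally show ?thesis .
qed

text \<open>
  Since $(1+x)^{\operatorname{wt}(u)} = (1+x)^{\operatorname{wt}(u)-1} + x (1+x)^{\operatorname{wt}(u)-1}$,
  subtracting $\pm v \ast u$ from $u \ast v$ leaves the second summand, in which $x$ cancels the pole.
\<close>

lemma zhu_commutator:
  assumes u: "u \<in> bipart V p b" and v: "v \<in> bipart V q a"
  shows "zhu_mult V u v - scl V (sgn_pow (p * q)) (zhu_mult V v u)
    - residue V (fps_binomial (of_real b - 1)) 0 u v \<in> zhu_O V"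
proof -
  let ?s = "sgn_pow (p * q)" and ?f = "fps_binomial (of_real b - 1 :: complex)"
  have "residue V (fps_binomial (of_real b)) 1 u v = residue V ?f 1 u v + residue V ?f 0 u v"
    using fps_binomial_Suc[of "of_real b - 1"] residue_X[of ?f 0] by (simp add: residue_add)
  moreover have "scl V (- ?s) (zhu_mult V v u - scl V ?s (residue V ?f 1 u v)) \<in> zhu_O V"
    using zhu_mult_swap[OF u v] by (intro subspace_scale zhu_O_subspace) (simp add: zhu_mult_weight[OF bipart_weight[OF v]])
  ultimately show ?thesis
    by (simp add: zhu_mult_weight[OF bipart_weight[OF u]] scale_right_diff_distrib)
qed

end

section \<open>The subspace $C_2(V)$\<close>

context dg_vertex_operator_algebra
begin

lemma C2_subspace: "subspace (C2 V)"
  by (simp add: C2_def)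

text \<open>
  By translation, $u_{-3-k}v$ is a nonzero multiple of $(L(-1)u)_{-2-k} v$.
\<close>

lemma mode_below_in_C2: "mode V u (-2 - int k) v \<in> C2 V"
proof (induction k arbitrary: u)
  case 0
  then show ?case by (auto simp: C2_def intro: span_base)
next
  case (Suc k)
  have "mode V (mode V u (-2) (vac V)) (-2 - int k) v = scl V (of_nat (k + 2)) (mode V u (-2 - int (Suc k)) v)"
    by (simp add: mode_translate algebra_simps)
  with Suc have "scl V (of_nat (k + 2)) (mode V u (-2 - int (Suc k)) v) \<in> C2 V" by metis
  then have "scl V (inverse (of_nat (k + 2))) (scl V (of_nat (k + 2)) (mode V u (-2 - int (Suc k)) v)) \<in> C2 V"
    by (rule subspace_scale[OF C2_subspace])
  moreover have "(of_nat (k + 2) :: complex) \<noteq> 0" unfolding of_nat_eq_0_iff by simp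
  ultimately show ?case by (simp del: of_nat_add)
qed

lemma mode_le_in_C2: "n \<le> -2 \<Longrightarrow> mode V u n v \<in> C2 V"
  using mode_below_in_C2[of u "nat (-2 - n)" v] by simp

lemma Sum_any_diff_first:
  fixes f :: "nat \<Rightarrow> 'a"
  assumes "subspace S" "\<And>i. f (Suc i) \<in> S" "\<exists>N. \<forall>i\<ge>N. f i = 0"
  shows "Sum_any f - f 0 \<in> S"
proof -
  obtain N where "\<forall>i\<ge>N. f i = 0" using assms(3) by blast
  then have "Sum_any f = sum f {..<Suc N}" by (intro Sum_any_atLeast0) auto
  then have "Sum_any f - f 0 = (\<Sum>i<N. f (Suc i))"
    unfolding sum.lessThan_Suc_shift by simp
  then show ?thesis using assms(1,2) by (simp add: subspace_sum)
qed

text \<open>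
  All but the first term of the skew symmetry formula have the form $w_{-1-i} 1$ with $i \ge 1$.
\<close>

lemma skew_symmetry_mod_C2:
  assumes "u \<in> deg_part V p" "v \<in> deg_part V q"
  shows "mode V v l u - scl V (sgn_pow (p * q) * sgn_pow (l + 1)) (mode V u l v) \<in> C2 V"
proof -
  let ?f = "\<lambda>i. scl V ((-1) ^ i) (mode V (mode V u (l + int i) v) (-1 - int i) (vac V))"
  have "Sum_any ?f - ?f 0 \<in> C2 V"
  proof (rule Sum_any_diff_first[OF C2_subspace])
    show "?f (Suc i) \<in> C2 V" for i
      by (intro subspace_scale[OF C2_subspace] mode_le_in_C2) simp
    show "\<exists>N. \<forall>i\<ge>N. ?f i = 0"
      using finite_nonzero_modes[of u "-l" v] by (auto simp: add.commute) (metis mode_left.zero scale_zero_right)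
  qed
  then have "Sum_any ?f - mode V u l v \<in> C2 V" by (simp add: creation)
  then have "scl V (sgn_pow (p * q) * sgn_pow (l + 1)) (Sum_any ?f - mode V u l v) \<in> C2 V"
    by (rule subspace_scale[OF C2_subspace])
  then show ?thesis
    unfolding skew_symmetry[OF assms, of l] by (simp only: scale_right_diff_distrib)
qed

text \<open>
  Commuting $u_m$ past $a_{-2}$ produces modes $(u_i a)_{m-2-i}$, whose index is at most $-2$.
\<close>

lemma C2_mode:
  assumes "m \<le> 0" "x \<in> C2 V"
  shows "mode V u m x \<in> C2 V"
proof (induction u rule: deg_induct)
  case (homogeneous p u)
  have "mode V u m (mode V a (-2) b) \<in> C2 V" for a b
  proof (induction a rule: deg_induct)
    case (homogeneous q a)
    have "mode V u m (mode V a (-2) b) - scl V (sgn_pow (p * q)) (mode V a (-2) (mode V u m b)) \<in> C2 V"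
      unfolding commutator[OF \<open>u \<in> deg_part V p\<close> homogeneous]
      by (intro subspace_Sum_any C2_subspace subspace_scale mode_le_in_C2) (use assms(1) in simp)
    moreover have "scl V (sgn_pow (p * q)) (mode V a (-2) (mode V u m b)) \<in> C2 V"
      by (intro subspace_scale C2_subspace mode_le_in_C2) simp
    ultimately show ?case using subspace_add[OF C2_subspace] by fastforce
  next
    case (add x y)
    then show ?case by (simp add: mode_left.add mode_right.add subspace_add[OF C2_subspace])
  qed
  then show ?case
    by (intro span_linear_into[OF mode_linear_right C2_subspace _ assms(2)[unfolded C2_def]]) blast
next
  case (add x y)
  then show ?case by (simp add: mode_left.add subspace_add[OF C2_subspace])
qed

lemma C2_codiff:
  assumes "x \<in> C2 V" shows "codiff V x \<in> C2 V"
proof (rule span_linear_into[OF codiff_linear C2_subspace _ assms[unfolded C2_def]])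
  fix x assume "x \<in> {mode V u (-2) v |u v. True}"
  then obtain a b where x: "x = mode V a (-2) b" by blast
  have "codiff V (mode V a (-2) b) \<in> C2 V"
  proof (induction a rule: deg_induct)
    case (homogeneous p a)
    have "codiff V (mode V a (-2) b) = mode V (codiff V a) (-2) b + scl V (sgn_pow p) (mode V a (-2) (codiff V b))"
      using mode_codiff[OF homogeneous, of "-2" b] by simp
    then show ?case
      by (auto intro!: subspace_add subspace_scale C2_subspace mode_le_in_C2)
  next
    case (add x y)
    then show ?case by (simp add: mode_left.add d.add subspace_add[OF C2_subspace])
  qed
  then show "codiff V x \<in> C2 V" by (simp add: x)
qed

text \<open>
  Associativity of $R(V)$: in the expansion of $(u_{-1}v)_{-1}w$ every term except $u_{-1}v_{-1}w$
  starts with a mode of index at most $-2$.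
\<close>

lemma iterate_product_mod_C2:
  "mode V (mode V u (-1) v) (-1) w - mode V u (-1) (mode V v (-1) w) \<in> C2 V"
proof (induction u rule: deg_induct)
  case (homogeneous p u)
  note u = this
  show ?case
  proof (induction v rule: deg_induct)
    case (homogeneous q v)
    let ?f = "\<lambda>i::nat. mode V u (-1 - int i) (mode V v (-1 + int i) w)
      + scl V (sgn_pow (p * q)) (mode V v (-2 - int i) (mode V u (int i) w))"
    have "Sum_any ?f - ?f 0 \<in> C2 V"
    proof (rule Sum_any_diff_first[OF C2_subspace])
      show "?f (Suc i) \<in> C2 V" for i
        by (intro subspace_add subspace_scale C2_subspace mode_le_in_C2) simp_all
      obtain N1 where 1: "\<forall>i\<ge>N1. mode V v (int i - 1) w = 0" using finite_nonzero_modes by blast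
      obtain N2 where 2: "\<forall>i\<ge>N2. mode V u (int i - 0) w = 0" using finite_nonzero_modes by blast
      have "?f i = 0" if "i \<ge> max N1 N2" for i using 1 2 that by simp
      then show "\<exists>N. \<forall>i\<ge>N. ?f i = 0" by blast
    qed
    moreover have "scl V (sgn_pow (p * q)) (mode V v (-2) (mode V u 0 w)) \<in> C2 V"
      by (intro subspace_scale C2_subspace mode_le_in_C2) simp
    ultimately have "Sum_any ?f - ?f 0 + scl V (sgn_pow (p * q)) (mode V v (-2) (mode V u 0 w)) \<in> C2 V"
      by (rule subspace_add[OF C2_subspace])
    then show ?case unfolding iterate_product[OF u homogeneous] by simp
  next
    case (add x y)
    have "mode V (mode V u (-1) (x + y)) (-1) w - mode V u (-1) (mode V (x + y) (-1) w)
      = (mode V (mode V u (-1) x) (-1) w - mode V u (-1) (mode V x (-1) w))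
      + (mode V (mode V u (-1) y) (-1) w - mode V u (-1) (mode V y (-1) w))"
      by (simp add: mode_left.add mode_right.add)
    with add show ?case by (simp only: subspace_add[OF C2_subspace])
  qed
next
  case (add x y)
  have "mode V (mode V (x + y) (-1) v) (-1) w - mode V (x + y) (-1) (mode V v (-1) w)
      = (mode V (mode V x (-1) v) (-1) w - mode V x (-1) (mode V v (-1) w))
      + (mode V (mode V y (-1) v) (-1) w - mode V y (-1) (mode V v (-1) w))"
    by (simp add: mode_left.add)
  with add show ?case by (simp only: subspace_add[OF C2_subspace])
qed

text \<open>
  Additivity in $u$ and $v$ lets a linear map on $C_2(V)$ be tested on products of bihomogeneous vectors.
\<close>

lemma C2_linear_into:
  assumes "lin f" "subspace S" "x \<in> C2 V"
    and "\<And>p a q b u v. u \<in> bipart V p a \<Longrightarrow> v \<in> bipart V q b \<Longrightarrow> f (mode V u (-2) v) \<in> S"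
  shows "f x \<in> S"
proof (rule span_linear_into[OF assms(1,2) _ assms(3)[unfolded C2_def]])
  interpret f: Vector_Spaces.linear "scl V" "scl V" f by fact
  have "f (mode V u (-2) v) \<in> S" for u v
  proof (induction u rule: bihom_induct)
    case (bihom p a u)
    note u = this
    show ?case
      by (induction v rule: bihom_induct)
        (auto simp: mode_right.add f.add intro: assms(4)[OF u] subspace_add[OF assms(2)])
  qed (simp add: mode_left.add f.add subspace_add[OF assms(2)])
  then show "f x \<in> S" if "x \<in> {mode V u (-2) v |u v. True}" for x using that by blast
qed

lemma C2_bicomponent:
  assumes "x \<in> C2 V" shows "bicomponent V p n x \<in> C2 V"
proof (rule C2_linear_into[OF _ C2_subspace assms])
  show "lin (bicomponent V p n)" by unfold_locales
  fix q a r b u v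
  assume "u \<in> bipart V q a" "v \<in> bipart V r b"
  \<comment> \<open>a bihomogeneous product is its own only nonzero component\<close>
  from bipart_mode[OF this, of "-2"] show "bicomponent V p n (mode V u (-2) v) \<in> C2 V"
    by (auto simp: bicomponent_bipart subspace_0[OF C2_subspace] mode_le_in_C2)
qed

text \<open>Modulo $C_2(V)$ left and right multiplications differ only by a sign.\<close>

lemma mode_right_closed:
  assumes K: "subspace K" "C2 V \<subseteq> K" "\<And>p n x. x \<in> K \<Longrightarrow> bicomponent V p n x \<in> K"
    and left: "\<And>v x. x \<in> K \<Longrightarrow> mode V v l x \<in> K" and x: "x \<in> K"
  shows "mode V x l v \<in> K"
proof (induction v rule: deg_induct)
  case (homogeneous q v)
  have hom: "mode V (bicomponent V p n x) l v \<in> K" for p n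
  proof -
    let ?x = "bicomponent V p n x"
    let ?c = "sgn_pow (q * p) * sgn_pow (l + 1)"
    have "mode V ?x l v - scl V ?c (mode V v l ?x) \<in> K"
      using skew_symmetry_mod_C2[OF homogeneous bipart_degree[OF bicomponent_in]] K(2) by blast
    moreover have "scl V ?c (mode V v l ?x) \<in> K"
      by (intro subspace_scale[OF K(1)] left K(3) x)
    ultimately show ?thesis using subspace_add[OF K(1)] by fastforce
  qed
  have "mode V x l v = (\<Sum>(p, n)\<in>{(p, n). bicomponent V p n x \<noteq> 0}. mode V (bicomponent V p n x) l v)"
    by (subst bicomponent_sum[of x, symmetric]) (simp add: mode_left.sum case_prod_unfold)
  also have "\<dots> \<in> K" by (intro subspace_sum[OF K(1)]) (auto simp: hom)
  finally show ?case .
next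
  case (add v w)
  then show ?case by (simp add: mode_right.add subspace_add[OF K(1)])
qed

end

section \<open>Quotients of $V$ by bigraded subspaces containing $C_2(V)$\<close>

text \<open>
  The quotient is given by an arbitrary projection \<open>\<pi>\<close> with kernel \<open>K\<close>, so that it may consist
  of cosets as well as of families of cosets.  The equations for the operations of \<open>A\<close> include their
  independence of representatives.
\<close>

locale poisson_quotient = dg_vertex_operator_algebra V
  for V :: "('a::ab_group_add, 'm) dg_voa_scheme" +
  fixes K :: "'a set" and A :: "('b, 'n) bigraded_poisson_scheme" (structure) and \<pi> :: "'a \<Rightarrow> 'b"
  assumes K_subspace: "subspace K"
    and C2_subset_K: "C2 V \<subseteq> K"
    and K_bicomponent: "x \<in> K \<Longrightarrow> bicomponent V p n x \<in> K"
    and proj_eq_iff: "\<pi> x = \<pi> y \<longleftrightarrow> x - y \<in> K"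
    and proj_carrier: "carrier A = range \<pi>"
    and proj_mult: "\<pi> x \<otimes> \<pi> y = \<pi> (mode V x (-1) y)"
    and proj_one: "\<one> = \<pi> (vac V)"
    and proj_zero: "\<zero> = \<pi> 0"
    and proj_add: "\<pi> x \<oplus> \<pi> y = \<pi> (x + y)"
    and proj_smult: "c \<odot> \<pi> x = \<pi> (scl V c x)"
    and proj_bracket: "bracket A (\<pi> x) (\<pi> y) = \<pi> (mode V x 0 y)"
    and proj_differential: "differential A (\<pi> x) = \<pi> (codiff V x)"
    and proj_part: "part A p n = \<pi> ` bipart V p n"
begin

lemma proj_eqI: "x - y \<in> C2 V \<Longrightarrow> \<pi> x = \<pi> y"
  using C2_subset_K proj_eq_iff by blast

lemma proj_in_carrier [simp]: "\<pi> x \<in> carrier A"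
  by (simp add: proj_carrier)

lemma carrierE: assumes "S \<in> carrier A" obtains x where "S = \<pi> x"
  using assms by (auto simp: proj_carrier)

lemma partE: assumes "S \<in> part A p n" obtains x where "S = \<pi> x" "x \<in> bipart V p n"
  using assms by (auto simp: proj_part)

lemma proj_in_part: "x \<in> bipart V p n \<Longrightarrow> \<pi> x \<in> part A p n"
  by (simp add: proj_part)

lemmas proj_simps = proj_mult proj_one proj_zero proj_add proj_smult proj_bracket proj_differential

lemma abelian_group: "abelian_group A"
proof (rule abelian_groupI)
  fix S assume "S \<in> carrier A"
  then obtain x where "S = \<pi> x" by (rule carrierE)
  then show "\<exists>T\<in>carrier A. T \<oplus> S = \<zero>"
    by (intro bexI[of _ "\<pi> (- x)"]) (auto simp: proj_simps)
qed (auto elim!: carrierE simp: proj_simps add_ac)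

lemma ring: "ring A"
proof (rule ringI[OF abelian_group])
  show "Group.monoid A"
    by (rule monoidI)
      (auto elim!: carrierE simp: proj_simps vac_mode creation intro!: proj_eqI iterate_product_mod_C2)
qed (auto elim!: carrierE simp: proj_simps mode_left.add mode_right.add)

lemma module: "Module.module (ring_of_type_algebra :: complex ring) A"
  by (rule Module.moduleI[OF cring_from_type_algebra abelian_group])
    (auto elim!: carrierE simp: proj_simps scale_left_distrib scale_right_distrib ring_of_type_algebra_def)

lemma proj_minus: "\<ominus> \<pi> x = \<pi> (- x)"
proof -
  interpret abelian_group A by (rule abelian_group)
  show ?thesis by (rule minus_equality) (auto simp: proj_simps)
qed

lemma proj_finsum:
  assumes "finite I" shows "(\<Oplus>i\<in>I. \<pi> (f i)) = \<pi> (sum f I)"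
proof -
  interpret abelian_group A by (rule abelian_group)
  show ?thesis using assms
    by (induction I rule: finite_induct) (auto simp: proj_simps Pi_def)
qed

text \<open>
  Existence and uniqueness both come from the bihomogeneous components of a representative: since
  \<open>K\<close> is bigraded, congruent vectors have congruent components.
\<close>

lemma part_direct_sum:
  assumes "S \<in> carrier A"
  shows "\<exists>!f. (\<forall>p n. f (p, n) \<in> part A p n) \<and> finite {i. f i \<noteq> \<zero>} \<and> S = (\<Oplus>i\<in>{i. f i \<noteq> \<zero>}. f i)"
proof -
  obtain x where S: "S = \<pi> x" using assms by (rule carrierE)
  define g where "g = (\<lambda>(p, n). \<pi> (bicomponent V p n x))"
  show ?thesis
  proof (rule ex1I[of _ g], intro conjI allI)
    let ?b = "\<lambda>(p, n). bicomponent V p n x"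
    show "g (p, n) \<in> part A p n" for p n
      by (simp add: g_def proj_in_part bicomponent_in)
    have sub: "{i. g i \<noteq> \<zero>} \<subseteq> {i. ?b i \<noteq> 0}"
      by (auto simp: g_def proj_zero)
    have fin: "finite {i. ?b i \<noteq> 0}" using finite_bicomponents[of x] by (simp add: case_prod_unfold)
    show finite: "finite {i. g i \<noteq> \<zero>}" using sub fin by (rule finite_subset)
    have "(\<Oplus>i\<in>{i. g i \<noteq> \<zero>}. g i) = \<pi> (sum ?b {i. g i \<noteq> \<zero>})"
      using proj_finsum[OF finite, of ?b] by (simp add: g_def case_prod_unfold)
    moreover have "x - sum ?b {i. g i \<noteq> \<zero>} = sum ?b ({i. ?b i \<noteq> 0} - {i. g i \<noteq> \<zero>})"
    proof -
      have "sum ?b {i. ?b i \<noteq> 0} = x" using bicomponent_sum[of x] by (simp add: case_prod_unfold)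
      then show ?thesis by (simp only: sum_diff[OF fin sub])
    qed
    moreover have "sum ?b ({i. ?b i \<noteq> 0} - {i. g i \<noteq> \<zero>}) \<in> K"
    proof (rule subspace_sum[OF K_subspace])
      fix i assume "i \<in> {i. ?b i \<noteq> 0} - {i. g i \<noteq> \<zero>}"
      then have "\<pi> (?b i) = \<pi> 0" by (auto simp: g_def proj_zero case_prod_unfold)
      then show "?b i \<in> K" by (simp add: proj_eq_iff)
    qed
    ultimately show "S = (\<Oplus>i\<in>{i. g i \<noteq> \<zero>}. g i)"
      by (simp add: S proj_eq_iff)
  next
    fix f assume f: "(\<forall>p n. f (p, n) \<in> part A p n) \<and> finite {i. f i \<noteq> \<zero>} \<and> S = (\<Oplus>i\<in>{i. f i \<noteq> \<zero>}. f i)"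
    let ?I = "{i. f i \<noteq> \<zero>}"
    have "\<exists>y. y \<in> bipart V (fst i) (snd i) \<and> f i = \<pi> y" for i
      using f by (metis partE prod.collapse)
    then obtain h where h: "\<And>i. h i \<in> bipart V (fst i) (snd i)" "\<And>i. f i = \<pi> (h i)" by metis
    have "f = (\<lambda>i. \<pi> (h i))" using h(2) by blast
    then have "S = \<pi> (sum h ?I)" using f proj_finsum[of ?I h] by simp
    then have eq: "x - sum h ?I \<in> K" by (simp add: S proj_eq_iff)
    show "f = g"
    proof
      fix i :: "int \<times> real"
      obtain p n where i: "i = (p, n)" by (cases i)
      have "bicomponent V p n (h j) = (if j = i then h j else 0)" for j
        using bicomponent_bipart[OF h(1)[of j], of p n] by (auto simp: i)
      then have "bicomponent V p n (sum h ?I) = (if i \<in> ?I then h i else 0)"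
        using f by (simp add: bic.sum)
      then have "bicomponent V p n x - (if i \<in> ?I then h i else 0) \<in> K"
        using K_bicomponent[OF eq, of p n] by (simp add: bic.diff)
      then have "\<pi> (bicomponent V p n x) = \<pi> (if i \<in> ?I then h i else 0)" by (simp add: proj_eq_iff)
      also have "\<dots> = f i" using h(2)[of i] by (auto simp: proj_zero)
      finally show "f i = g i" by (simp add: g_def i)
    qed
  qed
qed

lemma weight_graded_dg_poisson: "weight_graded_dg_poisson_algebra A"
proof -
  interpret mod: Module.module "ring_of_type_algebra :: complex ring" A by (rule module)
  show ?thesis
  proof (intro weight_graded_dg_poisson_algebra.intro module ring weight_graded_dg_poisson_algebra_axioms.intro)
    fix S T U assume "S \<in> carrier A" "T \<in> carrier A" "U \<in> carrier A"
    then show "bracket A (S \<oplus> T) U = bracket A S U \<oplus> bracket A T U"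
      "bracket A S (T \<oplus> U) = bracket A S T \<oplus> bracket A S U"
      by (auto elim!: carrierE simp: proj_simps mode_left.add mode_right.add)
  next
    fix S T c assume "S \<in> carrier A" "T \<in> carrier A"
    then show "(c \<odot> S) \<otimes> T = c \<odot> (S \<otimes> T)" "S \<otimes> (c \<odot> T) = c \<odot> (S \<otimes> T)"
      "bracket A S T \<in> carrier A"
      "bracket A (c \<odot> S) T = c \<odot> bracket A S T" "bracket A S (c \<odot> T) = c \<odot> bracket A S T"
      "differential A (S \<oplus> T) = differential A S \<oplus> differential A T"
      by (auto elim!: carrierE simp: proj_simps mode_left.scale mode_right.scale d.add)
  next
    fix S c assume "S \<in> carrier A"
    then show "differential A S \<in> carrier A" "differential A (c \<odot> S) = c \<odot> differential A S"
      "differential A (differential A S) = \<zero>"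
      by (auto elim!: carrierE simp: proj_simps d.scale codiff_codiff)
  next
    fix S assume "S \<in> carrier A"
    then show "\<exists>!f. (\<forall>p n. f (p, n) \<in> part A p n) \<and> finite {i. f i \<noteq> \<zero>} \<and> S = (\<Oplus>i\<in>{i. f i \<noteq> \<zero>}. f i)"
      by (rule part_direct_sum)
  next
    fix p n
    show "submodule (part A p n) (ring_of_type_algebra :: complex ring) A"
    proof (rule mod.submoduleI)
      show "part A p n \<subseteq> carrier A" by (auto simp: proj_part)
      show "\<zero> \<in> part A p n" unfolding proj_zero by (rule proj_in_part) simp
    qed (auto elim!: partE simp: proj_simps proj_minus
        intro!: proj_in_part subspace_neg subspace_add subspace_scale bipart_subspace)
    show "2 * n \<in> \<int>" if "part A p n \<noteq> {\<zero>}"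
    proof -
      have "weight_space V n \<noteq> {0}"
      proof
        assume "weight_space V n = {0}"
        then have "bipart V p n = {0}" using zero_in_bipart[of p n] unfolding bipart_def by blast
        then show False using that by (simp add: proj_part proj_zero)
      qed
      then show ?thesis by (rule weight_half_integral)
    qed
  next
    show "\<one> \<in> part A 0 0" unfolding proj_one by (rule proj_in_part[OF bipart_vac])
  next
    fix S p m assume "S \<in> part A p m"
    then show "differential A S \<in> part A (p + 1) m"
      by (auto elim!: partE simp: proj_simps intro!: proj_in_part bipart_codiff)
  next
    fix S p m T q n assume "S \<in> part A p m" "T \<in> part A q n"
    then obtain x y where S: "S = \<pi> x" "x \<in> bipart V p m" and T: "T = \<pi> y" "y \<in> bipart V q n"
      by (auto elim!: partE)
    note deg = bipart_degree[OF S(2)] bipart_degree[OF T(2)]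
    show "S \<otimes> T \<in> part A (p + q) (m + n)"
      using bipart_mode[OF S(2) T(2), of "-1"] by (simp add: S T proj_simps proj_in_part)
    show "bracket A S T \<in> part A (p + q - 2) (m + n - 1)"
      using bipart_mode[OF S(2) T(2), of 0] by (simp add: S T proj_simps proj_in_part)
    have d: "codiff V (mode V x k y) = mode V (codiff V x) k y + scl V (sgn_pow p) (mode V x k (codiff V y))" for k
      using mode_codiff[OF deg(1)] by simp
    show "differential A (S \<otimes> T) = (differential A S \<otimes> T) \<oplus> (sgn_pow p \<odot> (S \<otimes> differential A T))"
      "differential A (bracket A S T) = bracket A (differential A S) T \<oplus> (sgn_pow p \<odot> bracket A S (differential A T))"
      by (simp_all add: S T proj_simps d)
    show "bracket A S T = \<ominus> (sgn_pow (p * q) \<odot> bracket A T S)"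
      using proj_eqI[OF skew_symmetry_mod_C2[OF deg(2,1), of 0]]
      by (simp add: S T proj_simps proj_minus mult.commute)
    fix U r k assume "U \<in> part A r k"
    then obtain z where U: "U = \<pi> z" by (auto elim!: partE)
    have comm: "mode V x 0 (mode V y l z) = mode V (mode V x 0 y) l z + scl V (sgn_pow (p * q)) (mode V y l (mode V x 0 z))" for l
    proof -
      have "Sum_any (\<lambda>i. scl V (of_int 0 gchoose i) (mode V (mode V x (int i) y) (0 + l - int i) z)) = mode V (mode V x 0 y) l z"
        by (subst Sum_any_single[of 0]) (auto simp: gr0_conv_Suc)
      then show ?thesis using commutator[OF deg, of 0 l z] by (simp add: algebra_simps)
    qed
    show "bracket A S (bracket A T U) = bracket A (bracket A S T) U \<oplus> (sgn_pow (p * q) \<odot> bracket A T (bracket A S U))"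
      "bracket A S (T \<otimes> U) = (bracket A S T \<otimes> U) \<oplus> (sgn_pow (p * q) \<odot> (T \<otimes> bracket A S U))"
      by (simp_all add: S T U proj_simps comm)
  qed
qed

end

lemma poisson_quotient_hom:
  assumes "poisson_quotient V K A \<pi>" "poisson_quotient V L B \<rho>"
    and h: "\<And>x. h (\<pi> x) = \<rho> x"
  shows "weight_graded_dg_poisson_hom A B h" "h ` carrier A = carrier B"
proof -
  interpret A: poisson_quotient V K A \<pi> by fact
  interpret B: poisson_quotient V L B \<rho> by fact
  interpret src: weight_graded_dg_poisson_algebra A by (rule A.weight_graded_dg_poisson)
  interpret tgt: weight_graded_dg_poisson_algebra B by (rule B.weight_graded_dg_poisson)
  show "weight_graded_dg_poisson_hom A B h"
  proof unfold_locales
    show "h \<in> ring_hom A B"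
      by (rule ring_hom_memI) (auto elim!: A.carrierE simp: A.proj_simps B.proj_simps h)
  qed (auto elim!: A.carrierE A.partE simp: A.proj_simps B.proj_simps h B.proj_in_part)
  show "h ` carrier A = carrier B"
    by (auto simp: A.proj_carrier B.proj_carrier h image_image)
qed

section \<open>Cosets\<close>

context vector_space
begin

lemma coset_eq_iff:
  assumes "subspace S" shows "x +o S = y +o S \<longleftrightarrow> x - y \<in> S"
proof
  assume "x +o S = y +o S"
  moreover have "x \<in> x +o S" using subspace_0[OF assms] by (metis add_0_right set_plus_intro2)
  ultimately show "x - y \<in> S" by (simp add: set_plus_imp_minus)
next
  assume *: "x - y \<in> S"
  have "z \<in> x +o S \<longleftrightarrow> z \<in> y +o S" for z
    using subspace_add[OF assms, of "z - x" "x - y"] subspace_diff[OF assms, of "z - y" "x - y"] *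
    by (auto simp flip: set_minus_plus)
  then show "x +o S = y +o S" by blast
qed

lemma coset_UN_eq:
  assumes "subspace S" "A \<noteq> {}" "\<And>a. a \<in> A \<Longrightarrow> g a - c \<in> S"
  shows "(\<Union>a\<in>A. g a +o S) = c +o S"
proof -
  have "g a +o S = c +o S" if "a \<in> A" for a
    using assms(3)[OF that] by (simp add: coset_eq_iff[OF assms(1)])
  then have "(\<Union>a\<in>A. g a +o S) = (\<Union>a\<in>A. c +o S)" by (rule SUP_cong[OF refl])
  with assms(2) show ?thesis by simp
qed

lemma coset_UN2_eq:
  assumes "subspace S" "A \<noteq> {}" "B \<noteq> {}" "\<And>a b. a \<in> A \<Longrightarrow> b \<in> B \<Longrightarrow> g a b - c \<in> S"
  shows "(\<Union>a\<in>A. \<Union>b\<in>B. g a b +o S) = c +o S"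
proof -
  have "(\<Union>b\<in>B. g a b +o S) = c +o S" if "a \<in> A" for a
    using assms(4)[OF that] by (rule coset_UN_eq[OF assms(1,3)])
  then have "(\<Union>a\<in>A. \<Union>b\<in>B. g a b +o S) = (\<Union>a\<in>A. c +o S)" by (rule SUP_cong[OF refl])
  with assms(2) show ?thesis by simp
qed

lemma self_in_coset: "subspace S \<Longrightarrow> x \<in> x +o S"
  by (metis add_0_right set_plus_intro2 subspace_0)

end

section \<open>The algebra $R(V)$\<close>

context dg_vertex_operator_algebra
begin

lemma C2_algebra_quotient: "poisson_quotient V (C2 V) (C2_algebra V) (\<lambda>u. u +o C2 V)"
proof unfold_locales
  have ne: "x +o C2 V \<noteq> {}" for x using self_in_coset[OF C2_subspace] by blast
  have right: "mode V x l v \<in> C2 V" if "x \<in> C2 V" "l \<le> 0" for x l v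
    by (rule mode_right_closed[of "C2 V"]) (use that C2_subspace C2_bicomponent C2_mode in auto)
  have diff: "mode V u l v - mode V x l y \<in> C2 V" if "u - x \<in> C2 V" "v - y \<in> C2 V" "l \<le> 0" for u v x y l
  proof -
    have "mode V u l v - mode V x l y = mode V (u - x) l v + mode V x l (v - y)"
      by (simp add: mode_left.diff mode_right.diff)
    also have "\<dots> \<in> C2 V"
      by (intro subspace_add[OF C2_subspace] right C2_mode that)
    finally show ?thesis .
  qed
  show "subspace (C2 V)" by (rule C2_subspace)
  show "C2 V \<subseteq> C2 V" by simp
  show "x \<in> C2 V \<Longrightarrow> bicomponent V p n x \<in> C2 V" for x p n by (rule C2_bicomponent)
  show "(x +o C2 V = y +o C2 V) = (x - y \<in> C2 V)" for x y by (rule coset_eq_iff[OF C2_subspace])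
  fix x y c
  show "(x +o C2 V) \<otimes>\<^bsub>C2_algebra V\<^esub> (y +o C2 V) = mode V x (-1) y +o C2 V"
    unfolding C2_algebra_def monoid.simps
    by (rule coset_UN2_eq[OF C2_subspace ne ne]) (auto intro: diff set_plus_imp_minus)
  show "bracket (C2_algebra V) (x +o C2 V) (y +o C2 V) = mode V x 0 y +o C2 V"
    unfolding C2_algebra_def bigraded_poisson.simps
    by (rule coset_UN2_eq[OF C2_subspace ne ne]) (auto intro: diff set_plus_imp_minus)
  show "(x +o C2 V) \<oplus>\<^bsub>C2_algebra V\<^esub> (y +o C2 V) = (x + y) +o C2 V"
    unfolding C2_algebra_def ring.simps
  proof (rule coset_UN2_eq[OF C2_subspace ne ne])
    fix a b assume "a \<in> x +o C2 V" "b \<in> y +o C2 V"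
    then show "a + b - (x + y) \<in> C2 V"
      using subspace_add[OF C2_subspace, of "a - x" "b - y"] by (simp add: set_plus_imp_minus algebra_simps)
  qed
  show "c \<odot>\<^bsub>C2_algebra V\<^esub> (x +o C2 V) = scl V c x +o C2 V"
    unfolding C2_algebra_def module.simps
    by (rule coset_UN_eq[OF C2_subspace ne])
      (auto intro: subspace_scale C2_subspace set_plus_imp_minus simp flip: scale_right_diff_distrib)
  show "differential (C2_algebra V) (x +o C2 V) = codiff V x +o C2 V"
    unfolding C2_algebra_def bigraded_poisson.simps
    by (rule coset_UN_eq[OF C2_subspace ne])
      (auto intro: C2_codiff set_plus_imp_minus simp flip: d.diff)
qed (simp_all add: C2_algebra_def)

section \<open>The subspaces $I_n^{[p]}$\<close>

lemma set_sum_subspace: "subspace S \<Longrightarrow> subspace T \<Longrightarrow> subspace (S + T)"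
proof -
  have "S + T = {x + y |x y. x \<in> S \<and> y \<in> T}" by (auto simp: set_plus_def)
  then show "subspace S \<Longrightarrow> subspace T \<Longrightarrow> subspace (S + T)" using subspace_sums by simp
qed

lemma gr_null_subspace: "subspace (gr_null V p n)"
  unfolding gr_null_def by (intro set_sum_subspace zhu_O_subspace subspace_span)

lemma zhu_O_subset_gr_null: "zhu_O V \<subseteq> gr_null V p n"
proof
  fix x assume "x \<in> zhu_O V"
  then have "x + 0 + 0 \<in> gr_null V p n"
    unfolding gr_null_def by (intro set_plus_intro span_zero)
  then show "x \<in> gr_null V p n" by simp
qed

lemma bipart_in_gr_null:
  assumes "x \<in> bipart V q m" "q \<le> p" "m \<le> n" "q < p \<or> m < n"
  shows "x \<in> gr_null V p n"
proof (cases "m < n")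
  case True
  then have "0 + x + 0 \<in> gr_null V p n"
    unfolding gr_null_def using assms
    by (intro set_plus_intro span_zero subspace_0[OF zhu_O_subspace] span_base) auto
  then show ?thesis by simp
next
  case False
  then have "0 + 0 + x \<in> gr_null V p n"
    unfolding gr_null_def using assms
    by (intro set_plus_intro span_zero subspace_0[OF zhu_O_subspace] span_base) auto
  then show ?thesis by simp
qed

lemma gr_null_linear_into:
  assumes "lin f" "subspace S" "x \<in> gr_null V p n" "\<And>y. y \<in> zhu_O V \<Longrightarrow> f y \<in> S"
    and "\<And>y q m. y \<in> bipart V q m \<Longrightarrow> q \<le> p \<Longrightarrow> m \<le> n \<Longrightarrow> q < p \<or> m < n \<Longrightarrow> f y \<in> S"
  shows "f x \<in> S"
proof -
  interpret f: Vector_Spaces.linear "scl V" "scl V" f by fact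
  obtain a b c where x: "x = a + b + c" and a: "a \<in> zhu_O V"
    and b: "b \<in> span (\<Union>{bipart V q m |q m. q \<le> p \<and> m < n})"
    and c: "c \<in> span (\<Union>{bipart V q m |q m. q < p \<and> m \<le> n})"
    using assms(3) unfolding gr_null_def by (auto elim!: set_plus_elim)
  have "f b \<in> S" by (rule span_linear_into[OF assms(1,2) _ b]) (auto intro: assms(5))
  moreover have "f c \<in> S" by (rule span_linear_into[OF assms(1,2) _ c]) (auto intro: assms(5))
  ultimately show ?thesis using assms(4)[OF a] by (simp add: x f.add subspace_add[OF assms(2)])
qed

text \<open>
  In $\operatorname{Res}_x f(x) x^{-k} Y(u,x)v = \sum_n f_n u_{n-k}v$ each step in $n$ lowers the
  degree by $2$ and the weight by $1$, so only the term with $n = 0$ survives in the associated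
  graded space.
\<close>

lemma residue_leading_term:
  assumes "u \<in> bipart V p a" "v \<in> bipart V q b"
  shows "residue V f k u v - scl V (fps_nth f 0) (mode V u (-k) v)
    \<in> gr_null V (p + q + 2 * k - 2) (a + b + of_int k - 1)"
proof -
  let ?f = "\<lambda>n. scl V (fps_nth f n) (mode V u (int n - k) v)"
  have "Sum_any ?f - ?f 0 \<in> gr_null V (p + q + 2 * k - 2) (a + b + of_int k - 1)"
  proof (rule Sum_any_diff_first[OF gr_null_subspace])
    fix n
    show "?f (Suc n) \<in> gr_null V (p + q + 2 * k - 2) (a + b + of_int k - 1)"
      by (intro subspace_scale[OF gr_null_subspace] bipart_in_gr_null[OF bipart_mode[OF assms]]) auto
  next
    obtain N where "\<forall>n\<ge>N. mode V u (int n - k) v = 0" using finite_nonzero_modes by blast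
    then show "\<exists>N. \<forall>n\<ge>N. ?f n = 0" by (intro exI[of _ N]) simp
  qed
  then show ?thesis by (simp add: residue_def)
qed

lemma residue_in_gr_null:
  assumes "u \<in> bipart V p a" "v \<in> bipart V q b"
    and le: "p + q + 2 * k - 2 \<le> r" "a + b + of_int k - 1 \<le> n"
    and lt: "p + q + 2 * k - 2 < r \<or> a + b + of_int k - 1 < n"
  shows "residue V f k u v \<in> gr_null V r n"
  unfolding residue_def
proof (intro subspace_Sum_any gr_null_subspace subspace_scale)
  show "mode V u (int i - k) v \<in> gr_null V r n" for i
    by (rule bipart_in_gr_null[OF bipart_mode[OF assms(1,2)]]) (use le lt in auto)
qed

lemma zhu_mult_leading_term:
  assumes "u \<in> bipart V p a" "v \<in> bipart V q b"
  shows "zhu_mult V u v - mode V u (-1) v \<in> gr_null V (p + q) (a + b)"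
  using residue_leading_term[OF assms, of "fps_binomial (of_real a)" 1]
  by (simp add: zhu_mult_weight[OF bipart_weight[OF assms(1)]])

lemma zhu_bracket_leading_term:
  assumes u: "u \<in> bipart V p a" and v: "v \<in> bipart V q b"
  shows "zhu_mult V u v - scl V (sgn_pow (p * q)) (zhu_mult V v u) - mode V u 0 v
    \<in> gr_null V (p + q - 2) (a + b - 1)"
proof -
  let ?r = "residue V (fps_binomial (of_real a - 1)) 0 u v"
  have "?r - mode V u 0 v \<in> gr_null V (p + q - 2) (a + b - 1)"
    using residue_leading_term[OF assms, of "fps_binomial (of_real a - 1)" 0] by simp
  moreover have "zhu_mult V u v - scl V (sgn_pow (p * q)) (zhu_mult V v u) - ?r
      \<in> gr_null V (p + q - 2) (a + b - 1)"
    using zhu_commutator[OF u v] zhu_O_subset_gr_null by blast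
  ultimately show ?thesis using subspace_add[OF gr_null_subspace] by fastforce
qed

lemma C2_product_in_gr_null:
  assumes "u \<in> bipart V p a" "v \<in> bipart V q b"
  shows "mode V u (-2) v \<in> gr_null V (p + q + 2) (a + b + 1)"
proof -
  let ?r = "residue V (fps_binomial (of_real a)) 2 u v"
  have "?r - mode V u (-2) v \<in> gr_null V (p + q + 2) (a + b + 1)"
    using residue_leading_term[OF assms, of "fps_binomial (of_real a)" 2] by (simp add: algebra_simps)
  moreover have "?r \<in> gr_null V (p + q + 2) (a + b + 1)"
    using residue_in_zhu_O[OF bipart_weight[OF assms(1)]] zhu_O_subset_gr_null by blast
  ultimately show ?thesis using subspace_diff[OF gr_null_subspace] by fastforce
qed

text \<open>
  On $x$ the operators $u_{-1}$ and $u \ast {}$ agree up to lower terms, and $u \ast {}$ preserves both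
  $O(V)$ and the filtration.
\<close>

lemma mode_minus1_gr_null:
  assumes u: "u \<in> bipart V p a" and x: "x \<in> bipart V q b" "x \<in> gr_null V q b"
  shows "mode V u (-1) x \<in> gr_null V (q + p) (b + a)"
proof -
  let ?r = "residue V (fps_binomial (of_real a)) 1 u"
  have "?r x \<in> gr_null V (q + p) (b + a)"
  proof (rule gr_null_linear_into[OF residue_linear_right gr_null_subspace x(2)])
    show "?r y \<in> gr_null V (q + p) (b + a)" if "y \<in> zhu_O V" for y
      using zhu_mult_zhu_O[OF u that] zhu_O_subset_gr_null by blast
    show "?r y \<in> gr_null V (q + p) (b + a)"
      if "y \<in> bipart V r m" "r \<le> q" "m \<le> b" "r < q \<or> m < b" for y r m
      by (rule residue_in_gr_null[OF u that(1)]) (use that in auto)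
  qed
  moreover have "?r x - mode V u (-1) x \<in> gr_null V (q + p) (b + a)"
    using residue_leading_term[OF u x(1), of "fps_binomial (of_real a)" 1] by (simp add: add.commute)
  ultimately show ?thesis using subspace_diff[OF gr_null_subspace] by fastforce
qed

text \<open>
  Here $u_0$ is replaced by the derivation $\operatorname{Res}_x (1+x)^{\operatorname{wt}(u)-1} Y(u,x)$ of
  which it is the leading term.
\<close>

lemma mode_0_gr_null:
  assumes u: "u \<in> bipart V p a" and x: "x \<in> bipart V q b" "x \<in> gr_null V q b"
  shows "mode V u 0 x \<in> gr_null V (q + (p - 2)) (b + (a - 1))"
proof -
  let ?r = "residue V (fps_binomial (of_real a - 1)) 0 u" and ?N = "gr_null V (q + (p - 2)) (b + (a - 1))"
  have "?r x \<in> ?N"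
  proof (rule gr_null_linear_into[OF residue_linear_right gr_null_subspace x(2)])
    show "?r y \<in> ?N" if "y \<in> zhu_O V" for y
      using zhu_derivation_zhu_O[OF u that] zhu_O_subset_gr_null by blast
    show "?r y \<in> ?N"
      if "y \<in> bipart V r m" "r \<le> q" "m \<le> b" "r < q \<or> m < b" for y r m
      by (rule residue_in_gr_null[OF u that(1)]) (use that in auto)
  qed
  moreover have "?r x - mode V u 0 x \<in> ?N"
    using residue_leading_term[OF u x(1), of "fps_binomial (of_real a - 1)" 0] by (simp add: algebra_simps)
  ultimately show ?thesis using subspace_diff[OF gr_null_subspace] by fastforce
qed

text \<open>
  The differential of $V$ preserves weights, hence also the series $f = (1+x)^{\operatorname{wt}(u)}$, and
  so this formula makes $O(V)$ closed under $d_V$.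
\<close>

lemma codiff_residue:
  assumes "u \<in> deg_part V p"
  shows "codiff V (residue V f k u v)
    = residue V f k (codiff V u) v + scl V (sgn_pow p) (residue V f k u (codiff V v))"
proof -
  obtain N1 where 1: "\<forall>n\<ge>N1. mode V u (int n - k) v = 0" using finite_nonzero_modes by blast
  obtain N2 where 2: "\<forall>n\<ge>N2. mode V (codiff V u) (int n - k) v = 0" using finite_nonzero_modes by blast
  obtain N3 where 3: "\<forall>n\<ge>N3. mode V u (int n - k) (codiff V v) = 0" using finite_nonzero_modes by blast
  define N where "N = max N1 (max N2 N3)"
  have d: "codiff V (mode V u n v) = mode V (codiff V u) n v + scl V (sgn_pow p) (mode V u n (codiff V v))" for n
    using mode_codiff[OF assms] by simp
  have r: "residue V f k u v = (\<Sum>n<N. scl V (fps_nth f n) (mode V u (int n - k) v))"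
    "residue V f k (codiff V u) v = (\<Sum>n<N. scl V (fps_nth f n) (mode V (codiff V u) (int n - k) v))"
    "residue V f k u (codiff V v) = (\<Sum>n<N. scl V (fps_nth f n) (mode V u (int n - k) (codiff V v)))"
    by (rule residue_eq_sum; use 1 2 3 in \<open>simp add: N_def\<close>)+
  show ?thesis
    unfolding r by (simp add: d.sum d.scale d scale_right_distrib sum.distrib scale_sum_right mult.commute)
qed

lemma codiff_gr_null:
  assumes "x \<in> gr_null V q b"
  shows "codiff V x \<in> gr_null V (q + 1) b"
proof (rule gr_null_linear_into[OF codiff_linear gr_null_subspace assms])
  fix y assume "y \<in> zhu_O V"
  then have y: "y \<in> span {residue V (fps_binomial (of_real a)) 2 u v |p a u v. u \<in> bipart V p a}"
    by (simp only: zhu_O_eq_span)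
  have "codiff V y \<in> zhu_O V"
  proof (rule span_linear_into[OF codiff_linear zhu_O_subspace _ y])
    fix y assume "y \<in> {residue V (fps_binomial (of_real a)) 2 u v |p a u v. u \<in> bipart V p a}"
    then obtain p a u v where u: "u \<in> bipart V p a" and y: "y = residue V (fps_binomial (of_real a)) 2 u v" by blast
    show "codiff V y \<in> zhu_O V"
      unfolding y codiff_residue[OF bipart_degree[OF u]]
      by (intro subspace_add subspace_scale zhu_O_subspace residue_in_zhu_O bipart_weight[OF u]
          codiff_weight)
  qed
  then show "codiff V y \<in> gr_null V (q + 1) b" using zhu_O_subset_gr_null by blast
next
  fix y r m assume "y \<in> bipart V r m" "r \<le> q" "m \<le> b" "r < q \<or> m < b"
  then show "codiff V y \<in> gr_null V (q + 1) b"
    by (intro bipart_in_gr_null[OF bipart_codiff]) auto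
qed

section \<open>The bigraded algebra of $A(V)$ as a quotient of $V$\<close>

definition gr_kernel :: "'a set" where
  "gr_kernel = {x. \<forall>p n. bicomponent V p n x \<in> gr_null V p n}"

lemma gr_kernel_subspace: "subspace gr_kernel"
  using gr_null_subspace unfolding subspace_def gr_kernel_def by (auto simp: bic.add bic.scale)

lemma gr_kernel_bipart:
  assumes "x \<in> bipart V p n"
  shows "x \<in> gr_kernel \<longleftrightarrow> x \<in> gr_null V p n"
  unfolding gr_kernel_def using assms
  by (auto simp: bicomponent_bipart subspace_0[OF gr_null_subspace])

lemma gr_kernel_bicomponent:
  assumes "x \<in> gr_kernel" shows "bicomponent V p n x \<in> gr_kernel"
  using assms gr_kernel_bipart[OF bicomponent_in] by (simp add: gr_kernel_def)

lemma gr_kernel_linear: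
  assumes "lin f" "\<And>q m y. y \<in> bipart V q m \<Longrightarrow> f y \<in> bipart V (q + a) (m + b)"
    and "\<And>q m y. y \<in> bipart V q m \<Longrightarrow> y \<in> gr_null V q m \<Longrightarrow> f y \<in> gr_null V (q + a) (m + b)"
    and "x \<in> gr_kernel"
  shows "f x \<in> gr_kernel"
  unfolding gr_kernel_def
proof (intro CollectI allI)
  fix p n
  have "f (bicomponent V (p - a) (n - b) x) \<in> gr_null V (p - a + a) (n - b + b)"
    using assms(4) by (intro assms(3) bicomponent_in) (simp add: gr_kernel_def)
  then show "bicomponent V p n (f x) \<in> gr_null V p n"
    by (simp add: bicomponent_shift[OF assms(1,2)])
qed

lemma C2_subset_gr_kernel: "C2 V \<subseteq> gr_kernel"
proof
  fix x assume x: "x \<in> C2 V"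
  have "lin (\<lambda>x. x)" by (rule linearI) simp_all
  then show "x \<in> gr_kernel"
  proof (rule C2_linear_into[OF _ gr_kernel_subspace x])
    fix p a q b u v assume uv: "u \<in> bipart V p a" "v \<in> bipart V q b"
    from bipart_mode[OF this, of "-2"] have "mode V u (-2) v \<in> bipart V (p + q + 2) (a + b + 1)"
      by (simp add: algebra_simps)
    from gr_kernel_bipart[OF this] show "mode V u (-2) v \<in> gr_kernel"
      using C2_product_in_gr_null[OF uv] by simp
  qed
qed

lemma gr_kernel_mult: "x \<in> gr_kernel \<Longrightarrow> mode V u (-1) x \<in> gr_kernel"
proof (induction u rule: bihom_induct)
  case (bihom p a u)
  show ?case
  proof (rule gr_kernel_linear[OF mode_linear_right _ _ bihom(2)])
    show "mode V u (-1) y \<in> bipart V (q + p) (m + a)" if "y \<in> bipart V q m" for q m y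
      using bipart_mode[OF bihom(1) that, of "-1"] by (simp add: add.commute)
  qed (rule mode_minus1_gr_null[OF bihom(1)])
qed (simp add: mode_left.add subspace_add[OF gr_kernel_subspace])

lemma gr_kernel_bracket: "x \<in> gr_kernel \<Longrightarrow> mode V u 0 x \<in> gr_kernel"
proof (induction u rule: bihom_induct)
  case (bihom p a u)
  show ?case
  proof (rule gr_kernel_linear[OF mode_linear_right _ _ bihom(2)])
    show "mode V u 0 y \<in> bipart V (q + (p - 2)) (m + (a - 1))" if "y \<in> bipart V q m" for q m y
      using bipart_mode[OF bihom(1) that, of 0] by (simp add: algebra_simps)
  qed (rule mode_0_gr_null[OF bihom(1)])
qed (simp add: mode_left.add subspace_add[OF gr_kernel_subspace])

lemma gr_kernel_mode_diff:
  assumes "u - x \<in> gr_kernel" "v - y \<in> gr_kernel" "l = -1 \<or> l = 0"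
  shows "mode V u l v - mode V x l y \<in> gr_kernel"
proof -
  have left: "mode V w l z \<in> gr_kernel" if "z \<in> gr_kernel" for w z
    using assms(3) that gr_kernel_mult gr_kernel_bracket by blast
  have right: "mode V z l w \<in> gr_kernel" if "z \<in> gr_kernel" for w z
    by (rule mode_right_closed[OF gr_kernel_subspace C2_subset_gr_kernel gr_kernel_bicomponent left that])
  have "mode V u l v - mode V x l y = mode V (u - x) l v + mode V x l (v - y)"
    by (simp add: mode_left.diff mode_right.diff)
  also have "\<dots> \<in> gr_kernel"
    by (intro subspace_add[OF gr_kernel_subspace] right left assms(1,2))
  finally show ?thesis .
qed

lemma gr_class_eq_iff: "gr_class V x = gr_class V y \<longleftrightarrow> x - y \<in> gr_kernel"
  by (auto simp: gr_class_def fun_eq_iff coset_eq_iff[OF gr_null_subspace] gr_kernel_def bic.diff)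

lemma gr_reps_class: "gr_reps V (gr_class V x) = {y. y - x \<in> gr_kernel}"
  by (auto simp: gr_reps_def gr_class_def gr_kernel_def bic.diff simp flip: set_minus_plus)

lemma gr_class_bipart: "u \<in> bipart V p n \<Longrightarrow> gr_class V u = gr_single V p n u"
  by (auto simp: gr_class_def gr_single_def bicomponent_bipart fun_eq_iff)

text \<open>
  A finitely supported family of classes of bihomogeneous vectors is the class of the sum of these
  vectors.
\<close>

lemma gr_carrier_eq: "gr_carrier V = range (gr_class V)"
proof
  show "range (gr_class V) \<subseteq> gr_carrier V"
  proof clarify
    fix x
    have "{(p, n). gr_class V x (p, n) \<noteq> gr_null V p n} \<subseteq> {(p, n). bicomponent V p n x \<noteq> 0}"
      by (auto simp: gr_class_def)
    then have "finite {(p, n). gr_class V x (p, n) \<noteq> gr_null V p n}"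
      using finite_bicomponents by (rule finite_subset)
    then show "gr_class V x \<in> gr_carrier V"
      by (auto simp: gr_carrier_def gr_class_def bicomponent_in)
  qed
  show "gr_carrier V \<subseteq> range (gr_class V)"
  proof
    fix F assume F: "F \<in> gr_carrier V"
    define S where "S = {(p, n). F (p, n) \<noteq> gr_null V p n}"
    have "finite S" using F by (simp add: gr_carrier_def S_def)
    have "\<exists>u. u \<in> bipart V (fst i) (snd i) \<and> F i = u +o gr_null V (fst i) (snd i)" for i
    proof -
      have "F (fst i, snd i) \<in> (\<lambda>u. u +o gr_null V (fst i) (snd i)) ` bipart V (fst i) (snd i)"
        using F unfolding gr_carrier_def by blast
      then show ?thesis by auto
    qed
    then obtain h where h: "\<And>i. h i \<in> bipart V (fst i) (snd i)"
      "\<And>i. F i = h i +o gr_null V (fst i) (snd i)" by metis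
    have "gr_class V (sum h S) (p, n) = F (p, n)" for p n
    proof -
      have "bicomponent V p n (h j) = (if j = (p, n) then h j else 0)" for j
        using bicomponent_bipart[OF h(1)[of j], of p n] by (cases j) auto
      then have "bicomponent V p n (sum h S) = (if (p, n) \<in> S then h (p, n) else 0)"
        using \<open>finite S\<close> by (simp add: bic.sum)
      then show ?thesis using h(2)[of "(p, n)"] by (auto simp: gr_class_def S_def)
    qed
    then have "gr_class V (sum h S) = F" by auto
    then show "F \<in> range (gr_class V)" by blast
  qed
qed

lemma zhu_mult_0_left: "zhu_mult V 0 v = 0"
  using zhu_mult_weight[OF zero_in_weight_space[of 0]] by (simp add: residue_left.zero)

lemma zhu_mult_0_right: "u \<in> bipart V p n \<Longrightarrow> zhu_mult V u 0 = 0"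
  by (simp add: zhu_mult_weight[OF bipart_weight] residue_right.zero)

lemma Sum_any_bicomponents:
  assumes "\<And>p n. bicomponent V p n x = 0 \<Longrightarrow> f p n = 0"
  shows "Sum_any (\<lambda>(p, n). f p n) = (\<Sum>(p, n)\<in>{(p, n). bicomponent V p n x \<noteq> 0}. f p n)"
  by (rule Sum_any.expand_superset[OF finite_bicomponents]) (use assms in auto)

lemma bicomponent_mode:
  "bicomponent V p n (mode V x l y) = (\<Sum>(p1, n1)\<in>{(p, n). bicomponent V p n x \<noteq> 0}.
    mode V (bicomponent V p1 n1 x) l (bicomponent V (p - (p1 - 2 * l - 2)) (n - (n1 - of_int l - 1)) y))"
proof -
  have shift: "bicomponent V p n (mode V (bicomponent V p1 n1 x) l y)
    = mode V (bicomponent V p1 n1 x) l (bicomponent V (p - (p1 - 2 * l - 2)) (n - (n1 - of_int l - 1)) y)" for p1 n1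
  proof (rule bicomponent_shift[OF mode_linear_right])
    fix q m z assume "z \<in> bipart V q m"
    from bipart_mode[OF bicomponent_in this, of p1 n1 x l]
    show "mode V (bicomponent V p1 n1 x) l z \<in> bipart V (q + (p1 - 2 * l - 2)) (m + (n1 - of_int l - 1))"
      by (simp add: algebra_simps)
  qed
  have "mode V x l y = (\<Sum>(p, n)\<in>{(p, n). bicomponent V p n x \<noteq> 0}. mode V (bicomponent V p n x) l y)"
    by (subst bicomponent_sum[of x, symmetric]) (simp add: mode_left.sum case_prod_unfold)
  then show ?thesis by (simp add: bic.sum case_prod_unfold shift)
qed

text \<open>
  The products of components that are collected in degree $p$ and weight $n$ are those whose leading
  terms make up the component of $x_{-1}y$ there.
\<close>

lemma gr_mult_comp_leading_term:
  "gr_mult_comp V x y p n - bicomponent V p n (mode V x (-1) y) \<in> gr_null V p n"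
proof -
  have "gr_mult_comp V x y p n = (\<Sum>(p1, n1)\<in>{(p, n). bicomponent V p n x \<noteq> 0}.
      zhu_mult V (bicomponent V p1 n1 x) (bicomponent V (p - p1) (n - n1) y))"
    unfolding gr_mult_comp_def by (rule Sum_any_bicomponents) (simp add: zhu_mult_0_left)
  then have "gr_mult_comp V x y p n - bicomponent V p n (mode V x (-1) y)
      = (\<Sum>(p1, n1)\<in>{(p, n). bicomponent V p n x \<noteq> 0}.
        zhu_mult V (bicomponent V p1 n1 x) (bicomponent V (p - p1) (n - n1) y)
        - mode V (bicomponent V p1 n1 x) (-1) (bicomponent V (p - p1) (n - n1) y))"
    by (simp add: bicomponent_mode sum_subtractf case_prod_unfold)
  also have "\<dots> \<in> gr_null V p n"
  proof (rule subspace_sum[OF gr_null_subspace], clarify)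
    fix p1 n1
    show "zhu_mult V (bicomponent V p1 n1 x) (bicomponent V (p - p1) (n - n1) y)
        - mode V (bicomponent V p1 n1 x) (-1) (bicomponent V (p - p1) (n - n1) y) \<in> gr_null V p n"
      using zhu_mult_leading_term[OF bicomponent_in bicomponent_in, of p1 n1 x "p - p1" "n - n1" y] by simp
  qed
  finally show ?thesis .
qed

lemma gr_bracket_comp_leading_term:
  "gr_bracket_comp V x y p n - bicomponent V p n (mode V x 0 y) \<in> gr_null V p n"
proof -
  let ?u = "\<lambda>p1 n1. bicomponent V p1 n1 x" and ?v = "\<lambda>p1 n1. bicomponent V (p + 2 - p1) (n + 1 - n1) y"
  let ?s = "\<lambda>p1. sgn_pow (p1 * (p + 2 - p1))"
  have "gr_bracket_comp V x y p n = (\<Sum>(p1, n1)\<in>{(p, n). bicomponent V p n x \<noteq> 0}.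
      zhu_mult V (?u p1 n1) (?v p1 n1) - scl V (?s p1) (zhu_mult V (?v p1 n1) (?u p1 n1)))"
    unfolding gr_bracket_comp_def Let_def
    by (rule Sum_any_bicomponents) (simp add: zhu_mult_0_left zhu_mult_0_right[OF bicomponent_in])
  moreover have "p - (p1 - 2 * 0 - 2) = p + 2 - p1" "n - (n1 - of_int 0 - 1) = n + 1 - n1" for p1 n1
    by simp_all
  ultimately have "gr_bracket_comp V x y p n - bicomponent V p n (mode V x 0 y)
      = (\<Sum>(p1, n1)\<in>{(p, n). bicomponent V p n x \<noteq> 0}.
        zhu_mult V (?u p1 n1) (?v p1 n1) - scl V (?s p1) (zhu_mult V (?v p1 n1) (?u p1 n1))
        - mode V (?u p1 n1) 0 (?v p1 n1))"
    by (simp only: bicomponent_mode sum_subtractf case_prod_unfold)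
  also have "\<dots> \<in> gr_null V p n"
  proof (rule subspace_sum[OF gr_null_subspace], clarify)
    fix p1 n1
    show "zhu_mult V (?u p1 n1) (?v p1 n1) - scl V (?s p1) (zhu_mult V (?v p1 n1) (?u p1 n1))
        - mode V (?u p1 n1) 0 (?v p1 n1) \<in> gr_null V p n"
      using zhu_bracket_leading_term[OF bicomponent_in bicomponent_in, of p1 n1 x "p + 2 - p1" "n + 1 - n1" y] by simp
  qed
  finally show ?thesis .
qed

lemma gr_zhu_algebra_quotient: "poisson_quotient V gr_kernel (gr_zhu_algebra V) (gr_class V)"
proof unfold_locales
  have reps_ne: "gr_reps V (gr_class V x) \<noteq> {}" for x
    using subspace_0[OF gr_kernel_subspace] by (auto simp: gr_reps_class intro: exI[of _ x])
  have class_ne: "gr_class V x (p, n) \<noteq> {}" for x p n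
    using self_in_coset[OF gr_null_subspace] by (auto simp: gr_class_def)
  have comp_diff: "a - bicomponent V p n y \<in> gr_null V p n"
    if "a - bicomponent V p n x \<in> gr_null V p n" "x - y \<in> gr_kernel" for a x y p n
  proof -
    have "bicomponent V p n x - bicomponent V p n y \<in> gr_null V p n"
      using that(2) by (simp add: gr_kernel_def bic.diff)
    from subspace_add[OF gr_null_subspace that(1) this] show ?thesis by simp
  qed
  show "subspace gr_kernel" by (rule gr_kernel_subspace)
  show "C2 V \<subseteq> gr_kernel" by (rule C2_subset_gr_kernel)
  show "x \<in> gr_kernel \<Longrightarrow> bicomponent V p n x \<in> gr_kernel" for x p n by (rule gr_kernel_bicomponent)
  show "(gr_class V x = gr_class V y) = (x - y \<in> gr_kernel)" for x y by (rule gr_class_eq_iff)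
  show "carrier (gr_zhu_algebra V) = range (gr_class V)" by (simp add: gr_zhu_algebra_def gr_carrier_eq)
  show "\<one>\<^bsub>gr_zhu_algebra V\<^esub> = gr_class V (vac V)" by (simp add: gr_zhu_algebra_def)
  show "\<zero>\<^bsub>gr_zhu_algebra V\<^esub> = gr_class V 0" by (auto simp: gr_zhu_algebra_def gr_class_def fun_eq_iff bic.zero)
  fix x y c
  show "gr_class V x \<otimes>\<^bsub>gr_zhu_algebra V\<^esub> gr_class V y = gr_class V (mode V x (-1) y)"
  proof (rule ext, clarify)
    fix p n
    have "(\<Union>a\<in>gr_reps V (gr_class V x). \<Union>b\<in>gr_reps V (gr_class V y). gr_mult_comp V a b p n +o gr_null V p n)
      = bicomponent V p n (mode V x (-1) y) +o gr_null V p n"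
      by (rule coset_UN2_eq[OF gr_null_subspace reps_ne reps_ne], rule comp_diff, rule gr_mult_comp_leading_term)
        (simp add: gr_reps_class gr_kernel_mode_diff)
    then show "(gr_class V x \<otimes>\<^bsub>gr_zhu_algebra V\<^esub> gr_class V y) (p, n) = gr_class V (mode V x (-1) y) (p, n)"
      by (simp add: gr_zhu_algebra_def gr_class_def)
  qed
  show "bracket (gr_zhu_algebra V) (gr_class V x) (gr_class V y) = gr_class V (mode V x 0 y)"
  proof (rule ext, clarify)
    fix p n
    have "(\<Union>a\<in>gr_reps V (gr_class V x). \<Union>b\<in>gr_reps V (gr_class V y). gr_bracket_comp V a b p n +o gr_null V p n)
      = bicomponent V p n (mode V x 0 y) +o gr_null V p n"
      by (rule coset_UN2_eq[OF gr_null_subspace reps_ne reps_ne], rule comp_diff, rule gr_bracket_comp_leading_term)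
        (simp add: gr_reps_class gr_kernel_mode_diff)
    then show "bracket (gr_zhu_algebra V) (gr_class V x) (gr_class V y) (p, n) = gr_class V (mode V x 0 y) (p, n)"
      by (simp add: gr_zhu_algebra_def gr_class_def)
  qed
  show "gr_class V x \<oplus>\<^bsub>gr_zhu_algebra V\<^esub> gr_class V y = gr_class V (x + y)"
  proof (rule ext, clarify)
    fix p n
    have "(\<Union>a\<in>gr_class V x (p, n). \<Union>b\<in>gr_class V y (p, n). (a + b) +o gr_null V p n)
      = bicomponent V p n (x + y) +o gr_null V p n"
    proof (rule coset_UN2_eq[OF gr_null_subspace class_ne class_ne])
      fix a b assume "a \<in> gr_class V x (p, n)" "b \<in> gr_class V y (p, n)"
      then have "a - bicomponent V p n x \<in> gr_null V p n" "b - bicomponent V p n y \<in> gr_null V p n"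
        by (simp_all add: gr_class_def set_plus_imp_minus)
      from subspace_add[OF gr_null_subspace this]
      show "a + b - bicomponent V p n (x + y) \<in> gr_null V p n" by (simp add: bic.add algebra_simps)
    qed
    then show "(gr_class V x \<oplus>\<^bsub>gr_zhu_algebra V\<^esub> gr_class V y) (p, n) = gr_class V (x + y) (p, n)"
      by (simp add: gr_zhu_algebra_def gr_class_def)
  qed
  show "c \<odot>\<^bsub>gr_zhu_algebra V\<^esub> gr_class V x = gr_class V (scl V c x)"
  proof (rule ext, clarify)
    fix p n
    have "(\<Union>a\<in>gr_class V x (p, n). scl V c a +o gr_null V p n) = bicomponent V p n (scl V c x) +o gr_null V p n"
    proof (rule coset_UN_eq[OF gr_null_subspace class_ne])
      fix a assume "a \<in> gr_class V x (p, n)"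
      then have "a - bicomponent V p n x \<in> gr_null V p n" by (simp add: gr_class_def set_plus_imp_minus)
      from subspace_scale[OF gr_null_subspace this, of c]
      show "scl V c a - bicomponent V p n (scl V c x) \<in> gr_null V p n"
        by (simp add: bic.scale scale_right_diff_distrib)
    qed
    then show "(c \<odot>\<^bsub>gr_zhu_algebra V\<^esub> gr_class V x) (p, n) = gr_class V (scl V c x) (p, n)"
      by (simp add: gr_zhu_algebra_def gr_class_def)
  qed
  show "differential (gr_zhu_algebra V) (gr_class V x) = gr_class V (codiff V x)"
  proof (rule ext, clarify)
    fix p n
    have dx: "bicomponent V p n (codiff V x) = codiff V (bicomponent V (p - 1) n x)"
      using bicomponent_shift[OF codiff_linear, of 1 0 p n x] bipart_codiff by simp
    have "(\<Union>a\<in>gr_class V x (p - 1, n) \<inter> bipart V (p - 1) n. codiff V a +o gr_null V p n)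
      = bicomponent V p n (codiff V x) +o gr_null V p n"
    proof (rule coset_UN_eq[OF gr_null_subspace])
      have "bicomponent V (p - 1) n x \<in> gr_class V x (p - 1, n) \<inter> bipart V (p - 1) n"
        by (simp add: gr_class_def self_in_coset[OF gr_null_subspace] bicomponent_in)
      then show "gr_class V x (p - 1, n) \<inter> bipart V (p - 1) n \<noteq> {}" by blast
      fix a assume "a \<in> gr_class V x (p - 1, n) \<inter> bipart V (p - 1) n"
      then have "a - bicomponent V (p - 1) n x \<in> gr_null V (p - 1) n"
        by (simp add: gr_class_def set_plus_imp_minus)
      from codiff_gr_null[OF this]
      show "codiff V a - bicomponent V p n (codiff V x) \<in> gr_null V p n" by (simp add: dx d.diff)
    qed
    then show "differential (gr_zhu_algebra V) (gr_class V x) (p, n) = gr_class V (codiff V x) (p, n)"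
      by (simp add: gr_zhu_algebra_def gr_class_def)
  qed
  fix p n
  show "part (gr_zhu_algebra V) p n = gr_class V ` bipart V p n"
  proof
    show "gr_class V ` bipart V p n \<subseteq> part (gr_zhu_algebra V) p n"
    proof clarify
      fix u assume u: "u \<in> bipart V p n"
      have "gr_class V u (q, m) = gr_null V q m" if "(q, m) \<noteq> (p, n)" for q m
        using that by (auto simp: gr_class_bipart[OF u] gr_single_def)
      then show "gr_class V u \<in> part (gr_zhu_algebra V) p n"
        by (simp add: gr_zhu_algebra_def gr_carrier_eq)
    qed
    show "part (gr_zhu_algebra V) p n \<subseteq> gr_class V ` bipart V p n"
    proof
      fix F assume "F \<in> part (gr_zhu_algebra V) p n"
      then have F: "F \<in> gr_carrier V" "\<And>q m. (q, m) \<noteq> (p, n) \<Longrightarrow> F (q, m) = gr_null V q m"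
        by (auto simp: gr_zhu_algebra_def)
      then have "F (p, n) \<in> (\<lambda>u. u +o gr_null V p n) ` bipart V p n"
        unfolding gr_carrier_def by blast
      then obtain u where u: "u \<in> bipart V p n" "F (p, n) = u +o gr_null V p n" by blast
      have "F = gr_class V u"
        unfolding gr_class_bipart[OF u(1)] gr_single_def using u(2) F(2) by (auto simp: fun_eq_iff)
      with u(1) show "F \<in> gr_class V ` bipart V p n" by blast
    qed
  qed
qed

lemma eta_coset: "eta V (x +o C2 V) = gr_class V x"
proof -
  have "gr_class V y = gr_class V x" if "y \<in> x +o C2 V" for y
    using set_plus_imp_minus[OF that] C2_subset_gr_kernel gr_class_eq_iff by blast
  moreover have "x \<in> x +o C2 V" by (rule self_in_coset[OF C2_subspace])
  ultimately have "(\<Union>y\<in>x +o C2 V. gr_class V y i) = gr_class V x i" for i by (metis (no_types, lifting) SUP_eq_const empty_iff)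
  then show ?thesis by (simp add: eta_def fun_eq_iff)
qed

end

theorem proposition6p17:
  fixes V :: "('a::ab_group_add, 'm) dg_voa_scheme"
  assumes "dg_vertex_operator_algebra V"
  shows "(\<forall>p n. \<forall>u\<in>bipart V p n. eta V (u +o C2 V) = gr_single V p n u)
    \<and> weight_graded_dg_poisson_hom (C2_algebra V) (gr_zhu_algebra V) (eta V)
    \<and> eta V ` carrier (C2_algebra V) = carrier (gr_zhu_algebra V)"
proof -
  interpret dg_vertex_operator_algebra V by fact
  note hom = poisson_quotient_hom[OF C2_algebra_quotient gr_zhu_algebra_quotient eta_coset]
  show ?thesis
    using hom by (simp add: eta_coset gr_class_bipart)
qed

end
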